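(* Let $n\ge1$, let $f,g:\mathbb{R}^n\to\mathbb{R}_{\ge0}$ be log-concave functions such that $$\lim_{|x|\to\infty}f(x)=\lim_{|x|\to\infty}g(x)=0,$$ and let $\lambda\in(0,1)$. If there exists a hyperplane $H\in\mathcal{L}^n_{n-1}$ such that $$\int_H \mathrm{proj}_H(f)(x)\,\mathrm{d} x=\int_H \mathrm{proj}_H(g)(x)\,\mathrm{d} x<\infty,$$ then $$\int_{\mathbb{R}^n}(1-\lambda) f\star\lambda g\,\mathrm{d} x \;\geq\;(1-\lambda)\int_{\mathbb{R}^n}f\,\mathrm{d} x +\lambda \int_{\mathbb{R}^n}g\,\mathrm{d} x.$$
   Context: Integrals over $H$ are with respect to $(n-1)$-dimensional Lebesgue measure on $H$; integrals of non-negative functions take values in $[0,\infty]$. $\mathcal{L}^n_{n-1}$ is the set of $(n-1)$-dimensional linear subspaces of $\mathbb{R}^n$. A function $f:\mathbb{R}^n\to\mathbb{R}_{\ge0}$ is log-concave if $f=e^{-u}$ with $u:\mathbb{R}^n\to\mathbb{R}\cup\{\infty\}$ convex (with $e^{-\infty}=0$). For $f,g:\mathbb{R}^n\to\mathbb{R}_{\ge0}$ and $\lambda\in(0,1)$, the Asplund sum $(1-\lambda) f\star\lambda g:\mathbb{R}^n\to\mathbb{R}_{\geq0}\cup\{\infty\}$ is $$\bigl((1-\lambda) f\star\lambda g\bigr)(x)=\sup_{(1-\lambda) x_1+\lambda x_2=x} f(x_1)^{1-\lambda} g(x_2)^{\lambda}.$$ For $f:\mathbb{R}^n\to\mathbb{R}_{\ge0}\cup\{\infty\}$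 and $H\in\mathcal{L}^n_{n-1}$ with unit normal vector $\nu$, $\mathrm{proj}_H(f):H\to\mathbb{R}_{\ge0}\cup\{\infty\}$ is defined by $\mathrm{proj}_H(f)(h)=\sup_{\alpha\in\mathbb{R}} f(h+\alpha\nu)$. *)

theory Defs
  imports "HOL-Analysis.Analysis"
begin

text \<open>Convexity of a function with values in \<open>\<real> \<union> {\<infinity>}\<close>. Only weights strictly between 0 and 1 occur,
  so no product \<open>0 * \<infinity>\<close> appears.\<close>

definition ext_convex :: "('a::real_vector \<Rightarrow> ereal) \<Rightarrow> bool" where
  "ext_convex u \<longleftrightarrow> (\<forall>x. u x \<noteq> -\<infinity>) \<and>
     (\<forall>x y. \<forall>t\<in>{0<..<1::real}.
        u ((1 - t) *\<^sub>R x + t *\<^sub>R y) \<le> ereal (1 - t) * u x + ereal t * u y)"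

definition exp_neg :: "ereal \<Rightarrow> real" where
  "exp_neg r = (if r = \<infinity> then 0 else exp (- real_of_ereal r))"

definition log_concave :: "('a::real_vector \<Rightarrow> real) \<Rightarrow> bool" where
  "log_concave f \<longleftrightarrow> (\<exists>u. ext_convex u \<and> (\<forall>x. f x = exp_neg (u x)))"

lemma log_concave_nonneg: "log_concave f \<Longrightarrow> 0 \<le> f x"
  by (auto simp: log_concave_def exp_neg_def)

text \<open>The function \<open>(1 - t) f \<star> t g\<close>; it may take the value \<open>\<infinity>\<close>. For \<open>a > 0\<close>, \<open>powr\<close> satisfies
  \<open>0 powr a = 0\<close>, as required.\<close>

definition asplund_sum ::
    "real \<Rightarrow> ('a::real_vector \<Rightarrow> real) \<Rightarrow> ('a \<Rightarrow> real) \<Rightarrow> 'a \<Rightarrow> ennreal" where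
  "asplund_sum t f g x =
     (SUP (x1, x2) \<in> {(x1, x2). (1 - t) *\<^sub>R x1 + t *\<^sub>R x2 = x}.
        ennreal (f x1 powr (1 - t) * g x2 powr t))"

definition is_unit_normal :: "'a::euclidean_space set \<Rightarrow> 'a \<Rightarrow> bool" where
  "is_unit_normal H \<nu> \<longleftrightarrow> norm \<nu> = 1 \<and> (\<forall>h\<in>H. h \<bullet> \<nu> = 0)"

text \<open>Intended for linear hyperplanes \<open>H\<close> and \<open>h \<in> H\<close>; the unit normal is then unique up to sign, and
  the supremum does not depend on the sign (\<open>proj_H_eq\<close> below).\<close>

definition proj_H :: "'a::euclidean_space set \<Rightarrow> ('a \<Rightarrow> ennreal) \<Rightarrow> 'a \<Rightarrow> ennreal" where
  "proj_H H f h = (let \<nu> = (SOME \<nu>. is_unit_normal H \<nu>) in SUP \<alpha>::real. f (h + \<alpha> *\<^sub>R \<nu>))"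

definition is_orthonormal_basis :: "'a::euclidean_space set \<Rightarrow> 'a set \<Rightarrow> bool" where
  "is_orthonormal_basis H B \<longleftrightarrow>
     B \<subseteq> H \<and> pairwise orthogonal B \<and> (\<forall>b\<in>B. norm b = 1) \<and> span B = H"

text \<open>Lebesgue measure of dimension \<open>dim H\<close> on a linear subspace \<open>H\<close>: the completed image of the
  product Lebesgue measure on coordinates with respect to an orthonormal basis of \<open>H\<close>. By rotation
  invariance it does not depend on the basis. The underlying space of this measure is \<open>H\<close>, and for
  \<open>H = {0}\<close> it is the unit point mass at 0.\<close>

definition subspace_lebesgue :: "'a::euclidean_space set \<Rightarrow> 'a measure" where
  "subspace_lebesgue H =
     (let B = (SOME B. is_orthonormal_basis H B) in
      completion (distr (Pi\<^sub>M B (\<lambda>_. lborel :: real measure)) (restrict_space borel H)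
                        (\<lambda>c. \<Sum>b\<in>B. c b *\<^sub>R b)))"

lemma is_orthonormal_basis_exists:
  assumes "subspace H"
  shows "\<exists>B. is_orthonormal_basis H B"
  using orthonormal_basis_subspace[OF assms] unfolding is_orthonormal_basis_def by metis

lemma space_subspace_lebesgue: "space (subspace_lebesgue H) = H"
  by (simp add: subspace_lebesgue_def Let_def space_restrict_space)

lemma is_unit_normal_exists:
  fixes H :: "'a::euclidean_space set"
  assumes "subspace H" "dim H < DIM('a)"
  shows "\<exists>\<nu>. is_unit_normal H \<nu>"
proof -
  obtain x where x: "x \<noteq> 0" "\<And>y. y \<in> span H \<Longrightarrow> orthogonal x y"
    using orthogonal_to_subspace_exists[OF assms(2)] by blast
  have "is_unit_normal H (x /\<^sub>R norm x)"
    using x by (auto simp: is_unit_normal_def orthogonal_def span_base inner_commute)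
  then show ?thesis by blast
qed

lemma is_unit_normal_unique:
  fixes H :: "'a::euclidean_space set"
  assumes "subspace H" "dim H = DIM('a) - 1" "is_unit_normal H \<mu>" "is_unit_normal H \<nu>"
  shows "\<mu> = \<nu> \<or> \<mu> = - \<nu>"
proof -
  have perp: "h \<bullet> \<nu> = 0" "h \<bullet> \<mu> = 0" if "h \<in> H" for h
    using assms that by (auto simp: is_unit_normal_def)
  have n: "norm \<nu> = 1" "norm \<mu> = 1" using assms by (auto simp: is_unit_normal_def)
  have nuH: "\<nu> \<notin> span H"
    using perp n assms(1) by (metis inner_eq_zero_iff norm_zero span_eq_iff zero_neq_one)
  have "dim (insert \<nu> H) = DIM('a)"
    using nuH assms(2) by (simp add: dim_insert)
  then have "span (insert \<nu> H) = UNIV" by (simp add: dim_eq_full)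
  then obtain k where k: "\<mu> - k *\<^sub>R \<nu> \<in> span H"
    by (metis UNIV_I span_breakdown_eq)
  then have "\<mu> - k *\<^sub>R \<nu> \<in> H" using assms(1) by (metis span_eq_iff)
  then have "(\<mu> - k *\<^sub>R \<nu>) \<bullet> (\<mu> - k *\<^sub>R \<nu>) = 0"
    using perp by (simp add: inner_diff_right)
  then have mu: "\<mu> = k *\<^sub>R \<nu>" by simp
  then have "\<bar>k\<bar> = 1" using n by simp
  then show ?thesis using mu by (cases "k \<ge> 0") auto
qed

lemma proj_H_eq:
  fixes H :: "'a::euclidean_space set"
  assumes "subspace H" "dim H = DIM('a) - 1" "is_unit_normal H \<nu>"
  shows "proj_H H f h = (SUP \<alpha>::real. f (h + \<alpha> *\<^sub>R \<nu>))"
proof -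
  define \<mu> where "\<mu> = (SOME \<nu>. is_unit_normal H \<nu>)"
  have "is_unit_normal H \<mu>" unfolding \<mu>_def using assms(3) by (rule someI)
  then consider "\<mu> = \<nu>" | "\<mu> = - \<nu>" using is_unit_normal_unique assms by blast
  then have "range (\<lambda>\<alpha>::real. f (h + \<alpha> *\<^sub>R \<mu>)) = range (\<lambda>\<alpha>::real. f (h + \<alpha> *\<^sub>R \<nu>))"
  proof cases
    case 2
    have "range (\<lambda>\<alpha>::real. f (h + \<alpha> *\<^sub>R \<mu>)) = (\<lambda>\<alpha>. f (h + \<alpha> *\<^sub>R \<nu>)) ` range (uminus :: real \<Rightarrow> real)"
      unfolding image_image 2 by simp
    then show ?thesis by simp
  qed simp
  then show ?thesis by (simp add: proj_H_def Let_def \<mu>_def[symmetric])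
qed

end

theory Submission
  imports Defs
begin

text \<open>Measure the region below the graph of \<open>proj_H H f\<close> in logarithmic height: a point \<open>(h, s)\<close> belongs
  to it iff the fibre \<open>{\<alpha>. f (h + \<alpha> *\<^sub>R \<nu>) > exp s}\<close> is nonempty, and the weight \<open>exp s\<close> gives it total
  mass \<open>\<integral> proj_H H f\<close>. Let \<open>a u\<close> be the mass of its part where the fibre has length at least \<open>u\<close>. Then
  \<open>\<integral> f = \<integral> a u du\<close> over \<open>u \<ge> 0\<close>, and \<open>a 0 = \<integral> proj_H H f\<close> is the supremum of \<open>a\<close>. With \<open>b\<close> and \<open>m\<close>
  defined likewise from \<open>g\<close> and the Asplund sum, Brunn-Minkowski on fibres and Prekopa-Leindler for the
  weight \<open>exp s\<close> give \<open>m ((1 - t) * u + t * v) \<ge> a u powr (1 - t) * b v powr t\<close>. As \<open>a\<close> and \<open>b\<close> have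
  the same supremum, one-dimensional Brunn-Minkowski applied to their superlevel sets yields the linear
  inequality.\<close>

section \<open>One-dimensional inequalities\<close>

text \<open>Prekopa-Leindler alone bounds m by a geometric mean. The gain to a linear mean comes
  from the variable u: if a u and b v both exceed a level, so does their geometric mean, hence
  superlevel sets of a and b at one common level combine linearly inside that of m. Brunn-Minkowski
  on the line fails when exactly one set is empty, so the level sets of a and b must become empty at
  the same level; equality of the two projection integrals provides this. The second obstacle is
  measurability. A log-concave function need not be Borel, and a sum of two measurable sets need not
  be measurable. Convexity supplies Lebesgue measurability; where Fubini or Prekopa-Leindler wants
  Borel data, functions are replaced by Borel representatives and sets by inner F-sigma sets or by
  interiors, each time up to null sets.\<close>

lemma nn_integral_exp_below:
  "(\<integral>\<^sup>+s. ennreal (exp s) * indicator {..b} s \<partial>lborel) = ennreal (exp b)"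
proof -
  have "(\<integral>\<^sup>+s. ennreal (exp s) * indicator {..b} s \<partial>lborel) =
      (\<integral>\<^sup>+s. ennreal (exp (- s)) * indicator {..b} (- s) \<partial>lborel)"
    by (subst nn_integral_real_affine[where c="-1" and t=0]) auto
  also have "\<dots> = (\<integral>\<^sup>+s. ennreal (exp (- s)) * indicator {- b..} s \<partial>lborel)"
    by (intro nn_integral_cong) (auto split: split_indicator)
  also have "\<dots> = ennreal (0 - (- exp (- (- b))))"
  proof (rule nn_integral_FTC_atLeast)
    show "((\<lambda>s::real. - exp (- s)) \<longlongrightarrow> 0) at_top"
      using tendsto_minus[OF filterlim_compose[OF exp_at_bot filterlim_uminus_at_bot_at_top]] by simp
  qed (auto intro!: derivative_eq_intros)
  finally show ?thesis by simp
qed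

text \<open>In the variable \<open>exp s\<close> the weight is the Jacobian, so this is the length
  of the interval of positive heights below \<open>c\<close>, with \<open>c = top\<close>
  allowed.\<close>

lemma layer_cake_exp:
  "(\<integral>\<^sup>+s. ennreal (exp s) * indicator {s. ennreal (exp s) < c} s \<partial>lborel) = c"
proof (cases c)
  case (real r)
  show ?thesis
  proof (cases "r = 0")
    case False
    with real have r: "0 < r" by auto
    have less: "ennreal (exp s) < c \<longleftrightarrow> s < ln r" for s
      using r real ln_less_cancel_iff[of "exp s" r]
      by (simp add: ennreal_less_iff)
    have "(\<integral>\<^sup>+s. ennreal (exp s) * indicator {s. ennreal (exp s) < c} s \<partial>lborel) =
        (\<integral>\<^sup>+s. ennreal (exp s) * indicator {..ln r} s \<partial>lborel)"
      unfolding less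
      by (intro nn_integral_cong_AE, use AE_lborel_singleton[of "ln r"] in eventually_elim)
         (auto split: split_indicator)
    then show ?thesis using r real by (simp add: nn_integral_exp_below)
  qed (use real in simp)
next
  case top
  define I where "I = (\<integral>\<^sup>+s. ennreal (exp s) * indicator {s. ennreal (exp s) < c} s \<partial>lborel)"
  have "ennreal (exp b) \<le> I" for b
  proof -
    have "(\<integral>\<^sup>+s. ennreal (exp s) * indicator {..b} s \<partial>lborel) \<le> I"
      unfolding I_def using top by (intro nn_integral_mono) (auto split: split_indicator)
    then show ?thesis by (simp add: nn_integral_exp_below)
  qed
  then have "ennreal r \<le> I" if "r > 0" for r
    using exp_ln[OF that] by metis
  from this[of "real (Suc n)" for n] have nI: "of_nat (Suc n) \<le> I" for n
    by (simp only: ennreal_of_nat_eq_real_of_nat of_nat_0_less_iff zero_less_Suc)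
  have "I = top"
  proof (rule ccontr)
    assume "I \<noteq> top"
    then obtain n where "I < of_nat n"
      using ennreal_Ex_less_of_nat[of I] by (auto simp: top.not_eq_extremum)
    also have "(of_nat n :: ennreal) \<le> of_nat (Suc n)" by simp
    also have "\<dots> \<le> I" by (rule nI)
    finally show False by simp
  qed
  then show ?thesis using top by (simp add: I_def)
qed

section \<open>Brunn-Minkowski on the line\<close>

lemma emeasure_lborel_affine:
  fixes A :: "real set"
  assumes "A \<in> sets borel" "c \<noteq> 0"
  shows "emeasure lborel A = ennreal \<bar>c\<bar> * emeasure lborel {x. t + c * x \<in> A}"
proof -
  have [measurable]: "{x. t + c * x \<in> A} \<in> sets borel"
    using assms(1) by measurable
  have "emeasure lborel A = ennreal \<bar>c\<bar> * (\<integral>\<^sup>+x. indicator A (t + c * x) \<partial>lborel)"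
    using assms nn_integral_real_affine[of "indicator A" c t] by simp
  also have "(\<integral>\<^sup>+x. indicator A (t + c * x) \<partial>lborel) =
      (\<integral>\<^sup>+x. indicator {x. t + c * x \<in> A} x \<partial>lborel)"
    by (intro nn_integral_cong) (auto split: split_indicator)
  finally show ?thesis by simp
qed

text \<open>Two translates, one of \<open>A\<close> by a point of \<open>B\<close> and one of
  \<open>B\<close> by a point of \<open>A\<close>, both lie in \<open>C\<close>. With the points
  chosen near the top of \<open>A\<close> and the bottom of \<open>B\<close>, the translates overlap
  in a short interval only. Extremes need not be attained, hence the epsilon.\<close>

lemma brunn_minkowski_real_bounded:
  fixes A B C :: "real set"
  assumes [measurable]: "A \<in> sets borel" "B \<in> sets borel" "C \<in> sets borel"
    and ne: "A \<noteq> {}" "B \<noteq> {}" and bd: "bdd_above A" "bdd_below B"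
    and sum: "\<And>a b. a \<in> A \<Longrightarrow> b \<in> B \<Longrightarrow> a + b \<in> C"
  shows "emeasure lborel A + emeasure lborel B \<le> emeasure lborel C"
proof (rule ennreal_le_epsilon)
  fix e :: real assume e: "0 < e"
  obtain a0 where a0: "a0 \<in> A" "Sup A - e / 2 < a0"
    using less_cSupE[of "Sup A - e / 2" A] e ne by auto
  obtain b0 where b0: "b0 \<in> B" "b0 < Inf B + e / 2"
    using cInf_lessD[of B "Inf B + e / 2"] e ne by auto
  \<comment> \<open>The translate of \<open>A\<close> by \<open>b0\<close>, spelled with the factor
    1 to match \<open>emeasure_lborel_affine\<close>.\<close>
  define A1 where "A1 = {x. - b0 + 1 * x \<in> A}"
  define B1 where "B1 = {x. - a0 + 1 * x \<in> B}"
  have [measurable]: "A1 \<in> sets borel" "B1 \<in> sets borel"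
    unfolding A1_def B1_def by measurable
  have "A1 \<union> B1 \<subseteq> C"
    using sum[OF _ b0(1)] sum[OF a0(1)] unfolding A1_def B1_def by fastforce
  then have un: "emeasure lborel (A1 \<union> B1) \<le> emeasure lborel C"
    by (intro emeasure_mono) auto
  have "A1 \<inter> B1 \<subseteq> {a0 + Inf B..Sup A + b0}"
    using cSup_upper[OF _ bd(1)] cInf_lower[OF _ bd(2)] unfolding A1_def B1_def by fastforce
  then have "emeasure lborel (A1 \<inter> B1) \<le> emeasure lborel {a0 + Inf B..Sup A + b0}"
    by (intro emeasure_mono) auto
  also have "\<dots> \<le> ennreal e"
    using a0 b0 e by (auto simp: emeasure_lborel_Icc_eq intro!: ennreal_leI)
  finally have int: "emeasure lborel (A1 \<inter> B1) \<le> ennreal e" .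
  have "emeasure lborel A + emeasure lborel B = emeasure lborel A1 + emeasure lborel B1"
    using emeasure_lborel_affine[of A 1 "- b0"] emeasure_lborel_affine[of B 1 "- a0"]
    by (simp add: A1_def B1_def)
  also have "\<dots> = emeasure lborel (A1 \<union> B1) + emeasure lborel (A1 \<inter> B1)"
    by (intro emeasure_Un_Int) auto
  also have "\<dots> \<le> emeasure lborel C + ennreal e"
    using un int by (rule add_mono)
  finally show "emeasure lborel A + emeasure lborel B \<le> emeasure lborel C + ennreal e" .
qed

lemma brunn_minkowski_real:
  fixes A B C :: "real set"
  assumes [measurable]: "A \<in> sets borel" "B \<in> sets borel" "C \<in> sets borel"
    and ne: "A \<noteq> {}" "B \<noteq> {}"
    and sum: "\<And>a b. a \<in> A \<Longrightarrow> b \<in> B \<Longrightarrow> a + b \<in> C"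
  shows "emeasure lborel A + emeasure lborel B \<le> emeasure lborel C"
proof -
  obtain a0 b0 where ab: "a0 \<in> A" "b0 \<in> B" using ne by auto
  \<comment> \<open>Cutting relative to points of the sets keeps every truncation nonempty.\<close>
  define A' where "A' k = A \<inter> {..a0 + real k}" for k
  define B' where "B' k = B \<inter> {b0 - real k..}" for k
  have inc: "incseq A'" "incseq B'"
    by (auto simp: incseq_def A'_def B'_def)
  have [measurable]: "A' k \<in> sets borel" "B' k \<in> sets borel" for k
    by (auto simp: A'_def B'_def)
  have AU: "(\<Union>k. A' k) = A"
  proof -
    have "\<exists>k. x \<le> a0 + real k" for x using real_arch_simple[of "x - a0"] by (auto simp: algebra_simps)
    then show ?thesis by (auto simp: A'_def)
  qed
  have BU: "(\<Union>k. B' k) = B"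
  proof -
    have "\<exists>k. b0 \<le> x + real k" for x using real_arch_simple[of "b0 - x"] by (auto simp: algebra_simps)
    then show ?thesis by (auto simp: B'_def algebra_simps)
  qed
  have "emeasure lborel A + emeasure lborel B = (SUP k. emeasure lborel (A' k)) + (SUP k. emeasure lborel (B' k))"
    using inc by (subst (1 2) SUP_emeasure_incseq) (auto simp: AU BU)
  also have "\<dots> = (SUP k. emeasure lborel (A' k) + emeasure lborel (B' k))"
    using inc by (intro ennreal_SUP_add[symmetric])
      (auto intro!: emeasure_mono monoI dest: monoD)
  also have "\<dots> \<le> emeasure lborel C"
  proof (rule SUP_least)
    fix k
    show "emeasure lborel (A' k) + emeasure lborel (B' k) \<le> emeasure lborel C"
    proof (rule brunn_minkowski_real_bounded)
      show "A' k \<noteq> {}" "B' k \<noteq> {}" using ab by (auto simp: A'_def B'_def)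
      show "bdd_above (A' k)" "bdd_below (B' k)" by (auto simp: A'_def B'_def)
      show "a + b \<in> C" if "a \<in> A' k" "b \<in> B' k" for a b
        using that by (intro sum) (auto simp: A'_def B'_def)
    qed auto
  qed
  finally show ?thesis .
qed

lemma brunn_minkowski_real_convex_comb:
  fixes A B C :: "real set"
  assumes [measurable]: "A \<in> sets borel" "B \<in> sets borel" "C \<in> sets borel"
    and ne: "A \<noteq> {}" "B \<noteq> {}" and t: "0 < t" "t < 1"
    and sum: "\<And>a b. a \<in> A \<Longrightarrow> b \<in> B \<Longrightarrow> (1 - t) * a + t * b \<in> C"
  shows "ennreal (1 - t) * emeasure lborel A + ennreal t * emeasure lborel B \<le> emeasure lborel C"
proof -
  \<comment> \<open>The dilate of \<open>A\<close> by \<open>1 - t\<close>, again in the form of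
    \<open>emeasure_lborel_affine\<close>.\<close>
  define A1 where "A1 = {x. 0 + inverse (1 - t) * x \<in> A}"
  define B1 where "B1 = {x. 0 + inverse t * x \<in> B}"
  have [measurable]: "A1 \<in> sets borel" "B1 \<in> sets borel"
    unfolding A1_def B1_def by measurable
  have A: "ennreal (1 - t) * emeasure lborel A = emeasure lborel A1"
    using emeasure_lborel_affine[of A "inverse (1 - t)" 0] t
    by (simp add: A1_def mult.assoc[symmetric] ennreal_mult'[symmetric])
  have B: "ennreal t * emeasure lborel B = emeasure lborel B1"
    using emeasure_lborel_affine[of B "inverse t" 0] t
    by (simp add: B1_def mult.assoc[symmetric] ennreal_mult'[symmetric])
  obtain a0 b0 where "a0 \<in> A" "b0 \<in> B" using ne by auto
  then have "(1 - t) * a0 \<in> A1" "t * b0 \<in> B1"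
    using t by (auto simp: A1_def B1_def mult.assoc[symmetric])
  moreover have "a + b \<in> C" if "a \<in> A1" "b \<in> B1" for a b
    using sum[of "inverse (1 - t) * a" "inverse t * b"] that t by (simp add: A1_def B1_def mult.assoc[symmetric])
  ultimately show ?thesis
    unfolding A B by (intro brunn_minkowski_real) auto
qed

text \<open>\<open>a powr (1 - t) * b powr t \<le> c\<close>, stated without powers of extended reals.\<close>

definition log_mean_less :: "real \<Rightarrow> ennreal \<Rightarrow> ennreal \<Rightarrow> ennreal \<Rightarrow> bool" where
  "log_mean_less t a b c \<longleftrightarrow>
     (\<forall>p q. ennreal (exp p) < a \<longrightarrow> ennreal (exp q) < b \<longrightarrow> ennreal (exp ((1 - t) * p + t * q)) < c)"

section \<open>Layer cake and the linear inequality on the line\<close>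

lemma nn_integral_layer_cake_exp:
  fixes f :: "'a::euclidean_space \<Rightarrow> ennreal"
  assumes [measurable]: "f \<in> borel_measurable borel"
  shows "(\<integral>\<^sup>+x. f x \<partial>lborel) = (\<integral>\<^sup>+s. ennreal (exp s) * emeasure lborel {x. ennreal (exp s) < f x} \<partial>lborel)"
proof -
  have "(\<integral>\<^sup>+x. f x \<partial>lborel) =
      (\<integral>\<^sup>+x. \<integral>\<^sup>+s. ennreal (exp s) * indicator {s. ennreal (exp s) < f x} s \<partial>lborel \<partial>lborel)"
    by (simp add: layer_cake_exp)
  also have "\<dots> = (\<integral>\<^sup>+s. \<integral>\<^sup>+x. ennreal (exp s) * indicator {s. ennreal (exp s) < f x} s \<partial>lborel \<partial>lborel)"
  proof (rule lborel_pair.Fubini'[symmetric])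
    have "{p \<in> space (borel \<Otimes>\<^sub>M borel). ennreal (exp (snd p)) < f (fst p)} \<in> sets (borel \<Otimes>\<^sub>M borel)"
      by measurable
    then have [measurable]: "{p. ennreal (exp (snd p)) < f (fst p)} \<in> sets (borel \<Otimes>\<^sub>M borel)"
      by (simp add: space_pair_measure)
    have "(\<lambda>p. ennreal (exp (snd p)) * indicator {p. ennreal (exp (snd p)) < f (fst p)} p)
        \<in> borel_measurable (lborel \<Otimes>\<^sub>M lborel)"
      by measurable
    then show "(\<lambda>(x, s). ennreal (exp s) * indicator {s. ennreal (exp s) < f x} s)
        \<in> borel_measurable (lborel \<Otimes>\<^sub>M lborel)"
      by (simp add: case_prod_unfold indicator_def)
  qed
  also have "\<dots> = (\<integral>\<^sup>+s. \<integral>\<^sup>+x. ennreal (exp s) * indicator {x. ennreal (exp s) < f x} x \<partial>lborel \<partial>lborel)"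
    by (intro nn_integral_cong) (auto split: split_indicator)
  also have "\<dots> = (\<integral>\<^sup>+s. ennreal (exp s) * emeasure lborel {x. ennreal (exp s) < f x} \<partial>lborel)"
    by (intro nn_integral_cong, subst nn_integral_cmult_indicator) auto
  finally show ?thesis .
qed

lemma measurable_emeasure_superlevel [measurable]:
  fixes f :: "'a::euclidean_space \<Rightarrow> ennreal"
  assumes [measurable]: "f \<in> borel_measurable borel"
  shows "(\<lambda>s. emeasure lborel {x. ennreal (exp s) < f x}) \<in> borel_measurable (borel :: real measure)"
proof -
  have "{p \<in> space (borel \<Otimes>\<^sub>M lborel). ennreal (exp (fst p)) < f (snd p)} \<in> sets (borel \<Otimes>\<^sub>M lborel)"
    by measurable
  from lborel.measurable_emeasure_Pair[OF this]
  show ?thesis by (simp add: space_pair_measure vimage_def)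
qed

text \<open>Brunn-Minkowski for superlevel sets, integrated over all levels. The premise
  \<open>lev\<close> amounts to a bound of \<open>h\<close> from below by the minimum of
  \<open>f x\<close> and \<open>g y\<close>, which is weaker than
  \<open>log_mean_less\<close>.\<close>

lemma log_mean_integral_real_equal_sup:
  fixes f g h :: "real \<Rightarrow> ennreal"
  assumes [measurable]: "f \<in> borel_measurable borel" "g \<in> borel_measurable borel" "h \<in> borel_measurable borel"
    and sup: "(SUP x. f x) = (SUP x. g x)" and t: "0 < t" "t < 1"
    and lev: "\<And>s x y. ennreal (exp s) < f x \<Longrightarrow> ennreal (exp s) < g y \<Longrightarrow>
      ennreal (exp s) < h ((1 - t) * x + t * y)"
  shows "ennreal (1 - t) * (\<integral>\<^sup>+x. f x \<partial>lborel) + ennreal t * (\<integral>\<^sup>+x. g x \<partial>lborel) \<le> (\<integral>\<^sup>+x. h x \<partial>lborel)"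
proof -
  let ?m = "\<lambda>f s. emeasure lborel {x::real. ennreal (exp s) < f x}"
  have "ennreal (1 - t) * (\<integral>\<^sup>+x. f x \<partial>lborel) + ennreal t * (\<integral>\<^sup>+x. g x \<partial>lborel) =
     (\<integral>\<^sup>+s. ennreal (1 - t) * (ennreal (exp s) * ?m f s) + ennreal t * (ennreal (exp s) * ?m g s) \<partial>lborel)"
    by (subst (1 2) nn_integral_layer_cake_exp) (auto simp: nn_integral_cmult nn_integral_add)
  also have "\<dots> \<le> (\<integral>\<^sup>+s. ennreal (exp s) * ?m h s \<partial>lborel)"
  proof (intro nn_integral_mono)
    fix s :: real
    \<comment> \<open>Equal suprema make both level sets nonempty, or both empty; in the latter case
      the left-hand side vanishes.\<close>
    have "ennreal (1 - t) * ?m f s + ennreal t * ?m g s \<le> ?m h s"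
    proof (cases "ennreal (exp s) < (SUP x. f x)")
      case True
      moreover from this have "ennreal (exp s) < (SUP x. g x)" by (simp add: sup)
      ultimately have "{x. ennreal (exp s) < f x} \<noteq> {}" "{x. ennreal (exp s) < g x} \<noteq> {}"
        by (auto simp: less_SUP_iff)
      then show ?thesis using t lev by (intro brunn_minkowski_real_convex_comb) auto
    next
      case False
      moreover from this have "\<not> ennreal (exp s) < (SUP x. g x)" by (simp add: sup)
      ultimately have "{x. ennreal (exp s) < f x} = {}" "{x. ennreal (exp s) < g x} = {}"
        by (auto simp: less_SUP_iff)
      then show ?thesis by simp
    qed
    from mult_left_mono[OF this, of "ennreal (exp s)"]
    show "ennreal (1 - t) * (ennreal (exp s) * ?m f s) + ennreal t * (ennreal (exp s) * ?m g s)
        \<le> ennreal (exp s) * ?m h s"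
      by (simp add: distrib_left mult_ac)
  qed
  also have "\<dots> = (\<integral>\<^sup>+x. h x \<partial>lborel)"
    by (subst (2) nn_integral_layer_cake_exp) auto
  finally show ?thesis .
qed

section \<open>The Prekopa-Leindler inequality\<close>

lemma ennreal_exp_less_mult_iff:
  "ennreal (exp s) < ennreal (exp a) * c \<longleftrightarrow> ennreal (exp (s - a)) < c"
proof (cases c)
  case (real r)
  then show ?thesis
    by (simp add: ennreal_mult'[symmetric] ennreal_less_iff exp_diff pos_divide_less_eq mult.commute)
qed (simp add: ennreal_mult_eq_top_iff ennreal_mult_top)

text \<open>The weighted arithmetic-geometric mean inequality in strict form: it leads from the
  linear bound for normalised functions back to a multiplicative one.\<close>

lemma exp_convex_comb_less:
  assumes "0 < t" "t < 1" "ennreal (exp p) < a" "ennreal (exp q) < b"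
  shows "ennreal (exp ((1 - t) * p + t * q)) < ennreal (1 - t) * a + ennreal t * b"
proof -
  have "exp ((1 - t) * p + t * q) \<le> (1 - t) * exp p + t * exp q"
    using convex_onD[OF exp_convex, of t p q] assms by simp
  then have "ennreal (exp ((1 - t) * p + t * q)) \<le> ennreal (1 - t) * ennreal (exp p) + ennreal t * ennreal (exp q)"
    using assms by (simp add: ennreal_mult'[symmetric] ennreal_plus[symmetric] ennreal_leI del: ennreal_plus)
  also have "\<dots> < ennreal (1 - t) * a + ennreal t * b"
    using assms by (intro add_strict_mono ennreal_mult_strict_left_mono) auto
  finally show ?thesis .
qed

text \<open>Truncation makes the suprema finite, and rescaling makes them equal.\<close>

lemma prekopa_leindler_real:
  fixes f g h :: "real \<Rightarrow> ennreal"
  assumes [measurable]: "f \<in> borel_measurable borel" "g \<in> borel_measurable borel" "h \<in> borel_measurable borel"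
    and t: "0 < t" "t < 1"
    and le: "\<And>x y. log_mean_less t (f x) (g y) (h ((1 - t) * x + t * y))"
  shows "log_mean_less t (\<integral>\<^sup>+x. f x \<partial>lborel) (\<integral>\<^sup>+x. g x \<partial>lborel) (\<integral>\<^sup>+x. h x \<partial>lborel)"
proof -
  have trunc: "\<exists>\<phi> a. \<phi> \<in> borel_measurable borel \<and> (\<forall>x. \<phi> x \<le> f x) \<and> (SUP x. \<phi> x) = ennreal (exp a) \<and>
      ennreal (exp p) < (\<integral>\<^sup>+x. \<phi> x \<partial>lborel)"
    if [measurable]: "f \<in> borel_measurable borel" and p: "ennreal (exp p) < (\<integral>\<^sup>+x. f x \<partial>lborel)"
    for p and f :: "real \<Rightarrow> ennreal"
  proof -
    have "(\<integral>\<^sup>+x. f x \<partial>lborel) = (\<integral>\<^sup>+x. (SUP n. min (f x) (of_nat n)) \<partial>lborel)"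
      by (intro nn_integral_cong) (simp add: inf_min[symmetric] inf_SUP[symmetric] ennreal_SUP_of_nat_eq_top)
    also have "\<dots> = (SUP n. \<integral>\<^sup>+x. min (f x) (of_nat n) \<partial>lborel)"
      by (intro nn_integral_monotone_convergence_SUP) (auto simp: incseq_def le_fun_def min_le_iff_disj)
    finally obtain n :: nat where n: "ennreal (exp p) < (\<integral>\<^sup>+x. min (f x) (of_nat n) \<partial>lborel)"
      using p by (auto simp: less_SUP_iff)
    define S where "S = (SUP x. min (f x) (of_nat n))"
    \<comment> \<open>The supremum must be positive and finite to have a logarithm; a zero supremum
      would make the integral vanish.\<close>
    have "S \<noteq> 0"
    proof
      assume "S = 0"
      then have "min (f x) (of_nat n) = 0" for x
        unfolding S_def by (metis SUP_upper UNIV_I le_zero_eq)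
      with n show False by simp
    qed
    moreover have "S \<le> of_nat n" unfolding S_def by (intro SUP_least) auto
    ultimately obtain r where "S = ennreal r" "0 < r"
      by (cases S) (auto simp: top_unique)
    then have "S = ennreal (exp (ln r))" by simp
    with n show ?thesis
      unfolding S_def by (intro exI[of _ "\<lambda>x. min (f x) (of_nat n)"] exI[of _ "ln r"]) auto
  qed
  show ?thesis
    unfolding log_mean_less_def
  proof (intro allI impI)
    fix p q
    assume pq: "ennreal (exp p) < (\<integral>\<^sup>+x. f x \<partial>lborel)" "ennreal (exp q) < (\<integral>\<^sup>+x. g x \<partial>lborel)"
    obtain \<phi> a where [measurable]: "\<phi> \<in> borel_measurable borel" and \<phi>: "\<And>x. \<phi> x \<le> f x"
      "(SUP x. \<phi> x) = ennreal (exp a)" "ennreal (exp p) < (\<integral>\<^sup>+x. \<phi> x \<partial>lborel)"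
      using trunc[OF _ pq(1)] by auto
    obtain \<psi> b where [measurable]: "\<psi> \<in> borel_measurable borel" and \<psi>: "\<And>x. \<psi> x \<le> g x"
      "(SUP x. \<psi> x) = ennreal (exp b)" "ennreal (exp q) < (\<integral>\<^sup>+x. \<psi> x \<partial>lborel)"
      using trunc[OF _ pq(2)] by auto
    \<comment> \<open>\<open>exp c\<close> is the geometric mean of the two suprema. Dividing
      \<open>h\<close> by it preserves the level condition once the other two functions are
      normalised to supremum 1.\<close>
    define c where "c = (1 - t) * a + t * b"
    have "ennreal (exp ((1 - t) * (p - a) + t * (q - b))) <
        ennreal (1 - t) * (\<integral>\<^sup>+x. ennreal (exp (- a)) * \<phi> x \<partial>lborel) +
        ennreal t * (\<integral>\<^sup>+x. ennreal (exp (- b)) * \<psi> x \<partial>lborel)"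
      using t \<phi>(3) \<psi>(3)
      by (intro exp_convex_comb_less) (auto simp: nn_integral_cmult ennreal_exp_less_mult_iff)
    also have "\<dots> \<le> (\<integral>\<^sup>+x. ennreal (exp (- c)) * h x \<partial>lborel)"
    proof (rule log_mean_integral_real_equal_sup)
      have "(SUP x. ennreal (exp (- a)) * \<phi> x) = 1" "(SUP x. ennreal (exp (- b)) * \<psi> x) = 1"
        by (simp_all add: SUP_mult_left_ennreal[symmetric] \<phi>(2) \<psi>(2) ennreal_mult'[symmetric] exp_add[symmetric])
      then show "(SUP x. ennreal (exp (- a)) * \<phi> x) = (SUP x. ennreal (exp (- b)) * \<psi> x)" by simp
      show "ennreal (exp s) < ennreal (exp (- c)) * h ((1 - t) * x + t * y)"
        if "ennreal (exp s) < ennreal (exp (- a)) * \<phi> x" "ennreal (exp s) < ennreal (exp (- b)) * \<psi> y" for s x y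
      proof -
        have "ennreal (exp (s + a)) < f x" "ennreal (exp (s + b)) < g y"
          using that \<phi>(1)[of x] \<psi>(1)[of y] by (auto simp: ennreal_exp_less_mult_iff)
        with le[of x y] have "ennreal (exp ((1 - t) * (s + a) + t * (s + b))) < h ((1 - t) * x + t * y)"
          by (auto simp: log_mean_less_def)
        also have "(1 - t) * (s + a) + t * (s + b) = s + c" by (simp add: c_def algebra_simps)
        finally show ?thesis by (simp add: ennreal_exp_less_mult_iff)
      qed
    qed (use t in auto)
    finally have "ennreal (exp ((1 - t) * (p - a) + t * (q - b) + c)) < (\<integral>\<^sup>+x. h x \<partial>lborel)"
      by (simp add: nn_integral_cmult ennreal_exp_less_mult_iff)
    also have "(1 - t) * (p - a) + t * (q - b) + c = (1 - t) * p + t * q"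
      by (simp add: c_def algebra_simps)
    finally show "ennreal (exp ((1 - t) * p + t * q)) < (\<integral>\<^sup>+x. h x \<partial>lborel)" .
  qed
qed

interpretation lborel_PiM: product_sigma_finite "\<lambda>_. lborel :: real measure" ..

text \<open>Tensorisation: the real case shows that integrating out one coordinate preserves
  \<open>log_mean_less\<close>, so the inner integrals satisfy the hypothesis for the remaining
  coordinates. Extensional functions are the points of the product space, and slices are measurable
  only along them.\<close>

lemma prekopa_leindler_PiM:
  fixes f g h :: "('i \<Rightarrow> real) \<Rightarrow> ennreal"
  assumes "finite I" and t: "0 < t" "t < 1"
    and "f \<in> borel_measurable (Pi\<^sub>M I (\<lambda>_. lborel))" "g \<in> borel_measurable (Pi\<^sub>M I (\<lambda>_. lborel))"
      "h \<in> borel_measurable (Pi\<^sub>M I (\<lambda>_. lborel))"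
    and "\<And>x y. x \<in> extensional I \<Longrightarrow> y \<in> extensional I \<Longrightarrow>
      log_mean_less t (f x) (g y) (h (\<lambda>i\<in>I. (1 - t) * x i + t * y i))"
  shows "log_mean_less t (\<integral>\<^sup>+x. f x \<partial>Pi\<^sub>M I (\<lambda>_. lborel)) (\<integral>\<^sup>+x. g x \<partial>Pi\<^sub>M I (\<lambda>_. lborel))
    (\<integral>\<^sup>+x. h x \<partial>Pi\<^sub>M I (\<lambda>_. lborel))"
  using assms(1,4-)
proof (induction I arbitrary: f g h rule: finite_induct)
  case empty
  \<comment> \<open>Over no coordinates the measure is the unit point mass at the everywhere
    undefined function.\<close>
  from empty.prems(4)[of "\<lambda>_. undefined" "\<lambda>_. undefined"] show ?case
    by (simp add: PiM_empty nn_integral_count_space_finite restrict_def)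
next
  case (insert i I)
  note [measurable] = insert.prems(1-3)
  have int: "(\<integral>\<^sup>+x. u x \<partial>Pi\<^sub>M (insert i I) (\<lambda>_. lborel)) = (\<integral>\<^sup>+x. \<integral>\<^sup>+a. u (x(i := a)) \<partial>lborel \<partial>Pi\<^sub>M I (\<lambda>_. lborel))"
    if "u \<in> borel_measurable (Pi\<^sub>M (insert i I) (\<lambda>_. lborel :: real measure))" for u
    using insert.hyps that by (intro lborel_PiM.product_nn_integral_insert) auto
  have upd: "(\<lambda>a. u (x(i := a))) \<in> borel_measurable borel"
    if "x \<in> extensional I" and u: "u \<in> borel_measurable (Pi\<^sub>M (insert i I) (\<lambda>_. lborel :: real measure))"
    for x and u :: "_ \<Rightarrow> ennreal"
  proof -
    have "(\<lambda>a. x(i := a)) \<in> lborel \<rightarrow>\<^sub>M Pi\<^sub>M (insert i I) (\<lambda>_. lborel :: real measure)"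
      using that insert.hyps
      by (intro measurable_component_update) (auto simp: space_PiM PiE_def)
    from measurable_compose[OF this u] show ?thesis by simp
  qed
  show ?case
    unfolding int[OF insert.prems(1)] int[OF insert.prems(2)] int[OF insert.prems(3)]
  proof (rule insert.IH)
    fix x y :: "'i \<Rightarrow> real" assume xy: "x \<in> extensional I" "y \<in> extensional I"
    let ?z = "\<lambda>j\<in>I. (1 - t) * x j + t * y j"
    show "log_mean_less t (\<integral>\<^sup>+a. f (x(i := a)) \<partial>lborel) (\<integral>\<^sup>+a. g (y(i := a)) \<partial>lborel)
        (\<integral>\<^sup>+a. h (?z(i := a)) \<partial>lborel)"
    proof (rule prekopa_leindler_real)
      fix a b :: real
      have "(\<lambda>j\<in>insert i I. (1 - t) * (x(i := a)) j + t * (y(i := b)) j) = ?z(i := (1 - t) * a + t * b)"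
        using insert.hyps by (auto simp: fun_eq_iff)
      moreover have "x(i := a) \<in> extensional (insert i I)" "y(i := b) \<in> extensional (insert i I)"
        using xy by (auto simp: extensional_def)
      ultimately show "log_mean_less t (f (x(i := a))) (g (y(i := b))) (h (?z(i := (1 - t) * a + t * b)))"
        using insert.prems(4)[of "x(i := a)" "y(i := b)"] by (simp only:)
    qed (use t xy insert.prems(1-3) in \<open>auto intro!: upd simp: PiE_def extensional_def\<close>)
  qed measurable
qed

lemma prekopa_leindler:
  fixes f g h :: "'a::euclidean_space \<Rightarrow> ennreal"
  assumes [measurable]: "f \<in> borel_measurable borel" "g \<in> borel_measurable borel" "h \<in> borel_measurable borel"
    and t: "0 < t" "t < 1"
    and le: "\<And>x y. log_mean_less t (f x) (g y) (h ((1 - t) *\<^sub>R x + t *\<^sub>R y))"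
  shows "log_mean_less t (\<integral>\<^sup>+x. f x \<partial>lborel) (\<integral>\<^sup>+x. g x \<partial>lborel) (\<integral>\<^sup>+x. h x \<partial>lborel)"
proof -
  have int: "(\<integral>\<^sup>+x. u x \<partial>lborel) =
      (\<integral>\<^sup>+c. u (\<Sum>b\<in>Basis. c b *\<^sub>R b) \<partial>Pi\<^sub>M Basis (\<lambda>_. lborel))"
    if [measurable]: "u \<in> borel_measurable borel" for u :: "'a \<Rightarrow> ennreal"
    by (subst lborel_eq) (simp add: nn_integral_distr)
  have comb: "(\<Sum>b\<in>Basis. (\<lambda>b\<in>Basis. (1 - t) * x b + t * y b) b *\<^sub>R b) =
      (1 - t) *\<^sub>R (\<Sum>b\<in>Basis. x b *\<^sub>R b) + t *\<^sub>R (\<Sum>b\<in>Basis. y b *\<^sub>R (b::'a))" for x y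
    by (simp add: scaleR_sum_right scaleR_add_left sum.distrib)
  show ?thesis
    unfolding int[OF assms(1)] int[OF assms(2)] int[OF assms(3)]
    using t by (intro prekopa_leindler_PiM) (auto simp only: comb le finite_Basis, measurable)
qed

section \<open>Sums of sets and an exponential weight\<close>

lemma borel_if_fsigma: "fsigma A \<Longrightarrow> A \<in> sets borel"
  by (induction rule: fsigma.induct) (auto intro!: borel_closed)

text \<open>Sums of Borel sets may fail to be Borel. F-sigma sets are countable unions of compact
  sets, and compact pieces have compact sums.\<close>

lemma sigma_compact_sum:
  fixes A B :: "'a::euclidean_space set"
  assumes "fsigma A" "fsigma B"
  shows "{(1 - t) *\<^sub>R x + t *\<^sub>R y | x y. x \<in> A \<and> y \<in> B} \<in> sets borel"
proof -
  obtain F G :: "nat \<Rightarrow> 'a set" where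
    F: "\<And>i. compact (F i)" "A = (\<Union>i. F i)" and G: "\<And>i. compact (G i)" "B = (\<Union>i. G i)"
    using assms unfolding fsigma_Union_compact by (metis mem_Collect_eq range_subsetD)
  have "{(1 - t) *\<^sub>R x + t *\<^sub>R y | x y. x \<in> A \<and> y \<in> B} =
      (\<Union>i j. (\<lambda>(x, y). (1 - t) *\<^sub>R x + t *\<^sub>R y) ` (F i \<times> G j))"
    unfolding F(2) G(2) by (auto simp: image_iff) blast
  moreover have "compact ((\<lambda>(x, y). (1 - t) *\<^sub>R x + t *\<^sub>R y) ` (F i \<times> G j))" for i j
    unfolding case_prod_unfold
    by (intro compact_continuous_image compact_Times F G continuous_intros)
  then have "(\<Union>i j. (\<lambda>(x, y). (1 - t) *\<^sub>R x + t *\<^sub>R y) ` (F i \<times> G j)) \<in> sets borel"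
    by (intro sets.countable_UN image_subsetI borel_compact) auto
  ultimately show ?thesis by simp
qed

text \<open>The logarithm of the weight is linear, so the weights satisfy the hypothesis of
  Prekopa-Leindler exactly. Inner F-sigma sets of full measure replace \<open>A\<close> and
  \<open>B\<close>; their Borel sum stands in for \<open>C\<close>, which is not assumed measurable,
  and monotonicity of the integral returns to \<open>C\<close>.\<close>

lemma prekopa_leindler_exp_weight:
  fixes A B C :: "'a::euclidean_space set"
  assumes sets: "A \<in> sets lebesgue" "B \<in> sets lebesgue" and t: "0 < t" "t < 1"
    and sub: "\<And>x y. x \<in> A \<Longrightarrow> y \<in> B \<Longrightarrow> (1 - t) *\<^sub>R x + t *\<^sub>R y \<in> C"
  shows "log_mean_less t (\<integral>\<^sup>+x. ennreal (exp (x \<bullet> \<nu>)) * indicator A x \<partial>lborel)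
    (\<integral>\<^sup>+x. ennreal (exp (x \<bullet> \<nu>)) * indicator B x \<partial>lborel)
    (\<integral>\<^sup>+x. ennreal (exp (x \<bullet> \<nu>)) * indicator C x \<partial>lborel)"
proof -
  have inner: "\<exists>A'. fsigma A' \<and> A' \<subseteq> A \<and>
      (\<integral>\<^sup>+x. ennreal (exp (x \<bullet> \<nu>)) * indicator A x \<partial>lborel) =
      (\<integral>\<^sup>+x. ennreal (exp (x \<bullet> \<nu>)) * indicator A' x \<partial>lborel)"
    if "A \<in> sets lebesgue" for A
  proof -
    obtain A' T where A': "fsigma A'" "T \<in> null_sets lebesgue" "A' \<union> T = A"
      using lebesgue_set_almost_fsigma[OF \<open>A \<in> sets lebesgue\<close>] by metis
    then have "AE x in lborel. x \<notin> T"
      by (metis AE_not_in AE_completion_iff)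
    then have "(\<integral>\<^sup>+x. ennreal (exp (x \<bullet> \<nu>)) * indicator A x \<partial>lborel) =
        (\<integral>\<^sup>+x. ennreal (exp (x \<bullet> \<nu>)) * indicator A' x \<partial>lborel)"
      using A'(3) by (intro nn_integral_cong_AE) (auto elim!: eventually_mono split: split_indicator)
    with A' show ?thesis by auto
  qed
  obtain A' where A': "fsigma A'" "A' \<subseteq> A" and intA:
    "(\<integral>\<^sup>+x. ennreal (exp (x \<bullet> \<nu>)) * indicator A x \<partial>lborel) = (\<integral>\<^sup>+x. ennreal (exp (x \<bullet> \<nu>)) * indicator A' x \<partial>lborel)"
    using inner[OF sets(1)] by auto
  obtain B' where B': "fsigma B'" "B' \<subseteq> B" and intB:
    "(\<integral>\<^sup>+x. ennreal (exp (x \<bullet> \<nu>)) * indicator B x \<partial>lborel) = (\<integral>\<^sup>+x. ennreal (exp (x \<bullet> \<nu>)) * indicator B' x \<partial>lborel)"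
    using inner[OF sets(2)] by auto
  define C' where "C' = {(1 - t) *\<^sub>R x + t *\<^sub>R y | x y. x \<in> A' \<and> y \<in> B'}"
  have [measurable]: "A' \<in> sets borel" "B' \<in> sets borel" "C' \<in> sets borel"
    using A' B' by (auto simp: C'_def sigma_compact_sum borel_if_fsigma)
  have "log_mean_less t (\<integral>\<^sup>+x. ennreal (exp (x \<bullet> \<nu>)) * indicator A' x \<partial>lborel)
      (\<integral>\<^sup>+x. ennreal (exp (x \<bullet> \<nu>)) * indicator B' x \<partial>lborel)
      (\<integral>\<^sup>+x. ennreal (exp (x \<bullet> \<nu>)) * indicator C' x \<partial>lborel)"
  proof (rule prekopa_leindler)
    fix x y
    show "log_mean_less t (ennreal (exp (x \<bullet> \<nu>)) * indicator A' x) (ennreal (exp (y \<bullet> \<nu>)) * indicator B' y)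
        (ennreal (exp (((1 - t) *\<^sub>R x + t *\<^sub>R y) \<bullet> \<nu>)) * indicator C' ((1 - t) *\<^sub>R x + t *\<^sub>R y))"
      unfolding log_mean_less_def
    proof (intro allI impI)
      fix p q
      assume "ennreal (exp p) < ennreal (exp (x \<bullet> \<nu>)) * indicator A' x"
        "ennreal (exp q) < ennreal (exp (y \<bullet> \<nu>)) * indicator B' y"
      then have *: "x \<in> A'" "p < x \<bullet> \<nu>" "y \<in> B'" "q < y \<bullet> \<nu>"
        by (auto simp: ennreal_less_iff split: split_indicator_asm)
      then have "(1 - t) *\<^sub>R x + t *\<^sub>R y \<in> C'" by (auto simp: C'_def)
      moreover have "(1 - t) * p + t * q < (1 - t) * (x \<bullet> \<nu>) + t * (y \<bullet> \<nu>)"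
        using * t by (intro add_strict_mono) auto
      ultimately show "ennreal (exp ((1 - t) * p + t * q)) <
          ennreal (exp (((1 - t) *\<^sub>R x + t *\<^sub>R y) \<bullet> \<nu>)) * indicator C' ((1 - t) *\<^sub>R x + t *\<^sub>R y)"
        by (simp add: inner_add_left ennreal_less_iff)
    qed
  qed (use t in measurable)
  moreover have "C' \<subseteq> C" using A' B' sub by (auto simp: C'_def)
  then have "(\<integral>\<^sup>+x. ennreal (exp (x \<bullet> \<nu>)) * indicator C' x \<partial>lborel) \<le>
      (\<integral>\<^sup>+x. ennreal (exp (x \<bullet> \<nu>)) * indicator C x \<partial>lborel)"
    by (intro nn_integral_mono) (auto split: split_indicator)
  ultimately show ?thesis
    unfolding intA intB log_mean_less_def by (meson less_le_trans)
qed

section \<open>Fibres in a fixed direction\<close>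

text \<open>The set differs from its interior by part of its frontier, which is negligible by
  convexity. Borel measurability can fail: an open disc with an arbitrary subset of its circle is
  convex.\<close>

lemma convex_lebesgue:
  fixes S :: "'a::euclidean_space set"
  assumes "convex S"
  shows "S \<in> sets lebesgue"
proof -
  have "S - interior S \<subseteq> frontier S"
    using closure_subset[of S] unfolding frontier_def by blast
  then have "negligible (S - interior S)"
    using negligible_convex_frontier[OF assms] by (rule negligible_subset[rotated])
  then have "S - interior S \<in> sets lebesgue"
    unfolding negligible_iff_null_sets by (rule null_setsD2)
  moreover have "interior S \<in> sets lebesgue"
    by (intro sets_completionI_sets) simp
  ultimately have "interior S \<union> (S - interior S) \<in> sets lebesgue"
    by (rule sets.Un[rotated])
  then show ?thesis using interior_subset[of S] by (simp add: Un_absorb1)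
qed

text \<open>On the line convex sets are Borel: an interval is the difference of two upward closed
  sets, and these have monotone indicators.\<close>

lemma convex_real_borel:
  fixes S :: "real set"
  assumes "convex S"
  shows "S \<in> sets borel"
proof -
  have mono_borel: "A \<in> sets borel" if "mono (indicator A :: real \<Rightarrow> real)" for A
  proof -
    have "{x \<in> space borel. indicator A x > (0::real)} \<in> sets borel"
      using borel_measurable_mono[OF that] by measurable
    then show ?thesis by (simp add: indicator_def)
  qed
  have ivl: "x \<in> S" if "a \<in> S" "b \<in> S" "a \<le> x" "x \<le> b" for a b x
    using assms that by (meson is_interval_convex_1 mem_is_interval_1_I)
  have up: "{x. \<exists>a\<in>S. a \<le> x} \<in> sets borel"
    by (rule mono_borel) (auto simp: mono_def indicator_def intro: order_trans)
  have down: "{x. \<forall>b\<in>S. b < x} \<in> sets borel"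
    by (rule mono_borel) (auto simp: mono_def indicator_def intro: less_le_trans)
  have "{x. \<exists>a\<in>S. a \<le> x} - {x. \<forall>b\<in>S. b < x} = S"
  proof (intro subset_antisym subsetI)
    fix x assume "x \<in> {x. \<exists>a\<in>S. a \<le> x} - {x. \<forall>b\<in>S. b < x}"
    then obtain a b where "a \<in> S" "b \<in> S" "a \<le> x" "x \<le> b"
      by (auto simp: not_less)
    then show "x \<in> S" by (rule ivl)
  qed auto
  then show ?thesis using sets.Diff[OF up down] by simp
qed

text \<open>A common notion for f, g and their Asplund sum, which may be infinite; it needs no
  convex exponent and no powers of \<open>top\<close>.\<close>

definition log_concave_ext :: "('a::real_vector \<Rightarrow> ennreal) \<Rightarrow> bool" where
  "log_concave_ext f \<longleftrightarrow>
     (\<forall>t\<in>{0<..<1}. \<forall>x y. log_mean_less t (f x) (f y) (f ((1 - t) *\<^sub>R x + t *\<^sub>R y)))"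

lemma convexI_open_segment:
  assumes "\<And>x y t. x \<in> S \<Longrightarrow> y \<in> S \<Longrightarrow> 0 < t \<Longrightarrow> t < 1 \<Longrightarrow> (1 - t) *\<^sub>R x + t *\<^sub>R y \<in> S"
  shows "convex S"
  unfolding convex_alt
proof (intro ballI allI impI)
  fix x y t assume "x \<in> S" "y \<in> S" and t: "0 \<le> t \<and> t \<le> (1::real)"
  then show "(1 - t) *\<^sub>R x + t *\<^sub>R y \<in> S"
    using assms[of x y t] by (cases "t = 0 \<or> t = 1") auto
qed

lemma log_concave_ext_superlevel:
  assumes "log_concave_ext f" "0 < t" "t < 1" "ennreal (exp s) < f x" "ennreal (exp s) < f y"
  shows "ennreal (exp s) < f ((1 - t) *\<^sub>R x + t *\<^sub>R y)"
proof -
  have "ennreal (exp ((1 - t) * s + t * s)) < f ((1 - t) *\<^sub>R x + t *\<^sub>R y)"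
    using assms by (auto simp: log_concave_ext_def log_mean_less_def)
  also have "(1 - t) * s + t * s = s" by (simp add: algebra_simps)
  finally show ?thesis .
qed

text \<open>Superlevel sets at positive levels are convex. Level 0 is not of the form
  \<open>exp s\<close> and is reached as a countable union over the levels
  \<open>exp (- real n)\<close>.\<close>

lemma log_concave_ext_measurable:
  fixes f :: "'a::euclidean_space \<Rightarrow> ennreal"
  assumes "log_concave_ext f"
  shows "f \<in> borel_measurable lebesgue"
proof (rule borel_measurableI_greater)
  fix c
  have exp: "{x. ennreal (exp s) < f x} \<in> sets lebesgue" for s
    using log_concave_ext_superlevel[OF assms]
    by (intro convex_lebesgue convexI_open_segment) auto
  have "{x. c < f x} \<in> sets lebesgue"
  proof (cases "c = 0 \<or> c = top")
    case False
    then obtain r where "c = ennreal r" "0 < r" by (cases c) auto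
    then show ?thesis using exp[of "ln r"] by simp
  next
    case True
    have "\<exists>n::nat. ennreal (exp (- real n)) < f x" if "0 < f x" for x
    proof -
      obtain r where r: "0 < r" "ennreal r < f x"
      proof (cases "f x")
        case (real r)
        then show ?thesis using that[of "r / 2"] \<open>0 < f x\<close> by (simp add: ennreal_less_iff)
      qed (use that[of 1] in simp)
      obtain n :: nat where "- ln r < real n" using reals_Archimedean2 by blast
      then have "exp (- real n) < exp (ln r)" by simp
      then have "exp (- real n) < r" using r by simp
      then have "ennreal (exp (- real n)) < ennreal r" by (simp add: ennreal_less_iff)
      then have "ennreal (exp (- real n)) < f x" using r(2) by (rule less_trans)
      then show ?thesis ..
    qed
    moreover have "0 < f x" if "ennreal (exp (- real n)) < f x" for x n
      using that by (rule le_less_trans[rotated]) simp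
    ultimately have "{x. 0 < f x} = (\<Union>n::nat. {x. ennreal (exp (- real n)) < f x})"
      by blast
    with exp True show ?thesis by auto
  qed
  then show "{x \<in> space lebesgue. c < f x} \<in> sets lebesgue" by simp
qed

text \<open>Points of \<open>'a\<close> play two roles: \<open>x = h + s *\<^sub>R \<nu>\<close> with \<open>h\<close> orthogonal to \<open>\<nu>\<close> also stands for
  the point \<open>(h, s)\<close> of the graph space of \<open>h\<close>, the height \<open>s\<close> being on a logarithmic scale.
  \<open>fibre \<nu> f x\<close> is the set of \<open>\<alpha>\<close> with \<open>f (h + \<alpha> *\<^sub>R \<nu>) > exp s\<close>.\<close>

definition fibre :: "'a::euclidean_space \<Rightarrow> ('a \<Rightarrow> ennreal) \<Rightarrow> 'a \<Rightarrow> real set" where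
  "fibre \<nu> f x = {\<alpha>. ennreal (exp (x \<bullet> \<nu>)) < f (x + (\<alpha> - x \<bullet> \<nu>) *\<^sub>R \<nu>)}"

text \<open>At \<open>u = 0\<close> the length bound is vacuous and nonemptiness is the whole
  condition, which makes the mass at 0 the integral of the projection. Nonemptiness is also what
  Brunn-Minkowski on fibres requires.\<close>

definition long_fibre_set :: "'a::euclidean_space \<Rightarrow> ('a \<Rightarrow> ennreal) \<Rightarrow> real \<Rightarrow> 'a set" where
  "long_fibre_set \<nu> f u = {x. fibre \<nu> f x \<noteq> {} \<and> ennreal u \<le> emeasure lborel (fibre \<nu> f x)}"

text \<open>The function a of the overview. Integrating over the whole space instead of pairs (h, s)
  keeps the argument free of coordinates on the hyperplane until the projection is
  identified.\<close>

definition long_fibre_mass :: "'a::euclidean_space \<Rightarrow> ('a \<Rightarrow> ennreal) \<Rightarrow> real \<Rightarrow> ennreal" where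
  "long_fibre_mass \<nu> f u = (\<integral>\<^sup>+x. ennreal (exp (x \<bullet> \<nu>)) * indicator (long_fibre_set \<nu> f u) x \<partial>lborel)"

text \<open>The evaluation point and the logarithmic height are both linear in the pair of
  \<open>x\<close> and \<open>\<alpha>\<close>, so the assumption applies with the two heights as p
  and q.\<close>

lemma fibre_convex_comb:
  assumes "\<And>x y. log_mean_less t (f x) (g y) (h ((1 - t) *\<^sub>R x + t *\<^sub>R y))"
    and "\<alpha> \<in> fibre \<nu> f x" "\<beta> \<in> fibre \<nu> g y"
  shows "(1 - t) * \<alpha> + t * \<beta> \<in> fibre \<nu> h ((1 - t) *\<^sub>R x + t *\<^sub>R y)"
proof -
  let ?z = "(1 - t) *\<^sub>R x + t *\<^sub>R y"
  have "?z + ((1 - t) * \<alpha> + t * \<beta> - ?z \<bullet> \<nu>) *\<^sub>R \<nu> =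
      (1 - t) *\<^sub>R (x + (\<alpha> - x \<bullet> \<nu>) *\<^sub>R \<nu>) + t *\<^sub>R (y + (\<beta> - y \<bullet> \<nu>) *\<^sub>R \<nu>)"
    by (simp add: algebra_simps inner_add_left)
  then show ?thesis
    using assms(2,3) assms(1)[of "x + (\<alpha> - x \<bullet> \<nu>) *\<^sub>R \<nu>" "y + (\<beta> - y \<bullet> \<nu>) *\<^sub>R \<nu>"]
    by (simp add: fibre_def log_mean_less_def inner_add_left)
qed

lemma fibre_borel:
  assumes "log_concave_ext f"
  shows "fibre \<nu> f x \<in> sets borel"
proof (intro convex_real_borel convexI_open_segment)
  fix \<alpha> \<beta> t :: real assume "\<alpha> \<in> fibre \<nu> f x" "\<beta> \<in> fibre \<nu> f x" "0 < t" "t < 1"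
  with assms have "(1 - t) * \<alpha> + t * \<beta> \<in> fibre \<nu> f ((1 - t) *\<^sub>R x + t *\<^sub>R x)"
    by (intro fibre_convex_comb) (auto simp: log_concave_ext_def)
  then show "(1 - t) *\<^sub>R \<alpha> + t *\<^sub>R \<beta> \<in> fibre \<nu> f x"
    by (simp add: algebra_simps)
qed

lemma long_fibre_set_convex_comb:
  assumes "log_concave_ext f" "log_concave_ext g" "log_concave_ext h" and t: "0 < t" "t < 1"
    and le: "\<And>x y. log_mean_less t (f x) (g y) (h ((1 - t) *\<^sub>R x + t *\<^sub>R y))"
    and uv: "0 \<le> u" "0 \<le> v"
    and x: "x \<in> long_fibre_set \<nu> f u" and y: "y \<in> long_fibre_set \<nu> g v"
  shows "(1 - t) *\<^sub>R x + t *\<^sub>R y \<in> long_fibre_set \<nu> h ((1 - t) * u + t * v)"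
proof -
  let ?z = "(1 - t) *\<^sub>R x + t *\<^sub>R y"
  have comb: "(1 - t) * \<alpha> + t * \<beta> \<in> fibre \<nu> h ?z" if "\<alpha> \<in> fibre \<nu> f x" "\<beta> \<in> fibre \<nu> g y" for \<alpha> \<beta>
    using le that by (rule fibre_convex_comb)
  have ne: "fibre \<nu> f x \<noteq> {}" "fibre \<nu> g y \<noteq> {}"
    using x y by (auto simp: long_fibre_set_def)
  have "ennreal ((1 - t) * u + t * v) = ennreal (1 - t) * ennreal u + ennreal t * ennreal v"
    using t uv by (simp add: ennreal_plus ennreal_mult')
  also have "\<dots> \<le> ennreal (1 - t) * emeasure lborel (fibre \<nu> f x) + ennreal t * emeasure lborel (fibre \<nu> g y)"
    using x y by (intro add_mono mult_left_mono) (auto simp: long_fibre_set_def)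
  also have "\<dots> \<le> emeasure lborel (fibre \<nu> h ?z)"
    using assms ne comb by (intro brunn_minkowski_real_convex_comb fibre_borel) auto
  finally have "ennreal ((1 - t) * u + t * v) \<le> emeasure lborel (fibre \<nu> h ?z)" .
  moreover have "fibre \<nu> h ?z \<noteq> {}" using ne comb by blast
  ultimately show ?thesis by (simp add: long_fibre_set_def)
qed

text \<open>Convexity is wanted for measure theory: it yields Lebesgue measurability and a
  negligible frontier.\<close>

lemma long_fibre_set_convex:
  assumes "log_concave_ext f" "0 \<le> u"
  shows "convex (long_fibre_set \<nu> f u)"
proof (rule convexI_open_segment)
  fix x y t assume "x \<in> long_fibre_set \<nu> f u" "y \<in> long_fibre_set \<nu> f u" "0 < t" "t < (1::real)"
  with assms have "(1 - t) *\<^sub>R x + t *\<^sub>R y \<in> long_fibre_set \<nu> f ((1 - t) * u + t * u)"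
    by (intro long_fibre_set_convex_comb) (auto simp: log_concave_ext_def)
  then show "(1 - t) *\<^sub>R x + t *\<^sub>R y \<in> long_fibre_set \<nu> f u"
    by (simp add: algebra_simps)
qed

text \<open>The linear map \<open>(x, \<alpha>) \<mapsto> (x + (\<alpha> - x \<bullet> \<nu>) *\<^sub>R \<nu>, x \<bullet> \<nu>)\<close> swaps the coordinate along \<open>\<nu>\<close> with \<open>\<alpha>\<close>.
  It is a product of shears and a reflection, so translation invariance suffices.\<close>

lemma nn_integral_swap_coordinate:
  fixes \<phi> :: "'a::euclidean_space \<Rightarrow> real \<Rightarrow> ennreal"
  assumes [measurable]: "case_prod \<phi> \<in> borel_measurable (borel \<Otimes>\<^sub>M borel)" and \<nu>: "\<nu> \<bullet> \<nu> = 1"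
  shows "(\<integral>\<^sup>+x. \<integral>\<^sup>+\<alpha>. \<phi> (x + (\<alpha> - x \<bullet> \<nu>) *\<^sub>R \<nu>) (x \<bullet> \<nu>) \<partial>lborel \<partial>lborel) =
    (\<integral>\<^sup>+x. \<integral>\<^sup>+s. \<phi> x s \<partial>lborel \<partial>lborel)"
proof -
  have \<phi>m: "(\<lambda>w. \<phi> (F w) (G w)) \<in> borel_measurable M"
    if "F \<in> borel_measurable M" "G \<in> borel_measurable M" for F G and M :: "'b measure"
    using measurable_compose[OF measurable_Pair[OF that] assms(1)] by simp
  have "(\<integral>\<^sup>+x. \<integral>\<^sup>+\<alpha>. \<phi> (x + (\<alpha> - x \<bullet> \<nu>) *\<^sub>R \<nu>) (x \<bullet> \<nu>) \<partial>lborel \<partial>lborel) =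
      (\<integral>\<^sup>+x. \<integral>\<^sup>+\<alpha>. \<phi> (x + \<alpha> *\<^sub>R \<nu>) (x \<bullet> \<nu>) \<partial>lborel \<partial>lborel)"
  proof (rule nn_integral_cong)
    fix x
    show "(\<integral>\<^sup>+\<alpha>. \<phi> (x + (\<alpha> - x \<bullet> \<nu>) *\<^sub>R \<nu>) (x \<bullet> \<nu>) \<partial>lborel) = (\<integral>\<^sup>+\<alpha>. \<phi> (x + \<alpha> *\<^sub>R \<nu>) (x \<bullet> \<nu>) \<partial>lborel)"
      by (subst (2) nn_integral_real_affine[where c=1 and t="- (x \<bullet> \<nu>)"]) (auto intro!: \<phi>m)
  qed
  also have "\<dots> = (\<integral>\<^sup>+\<alpha>. \<integral>\<^sup>+x. \<phi> (x + \<alpha> *\<^sub>R \<nu>) (x \<bullet> \<nu>) \<partial>lborel \<partial>lborel)"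
    by (rule lborel_pair.Fubini'[symmetric]) (unfold case_prod_unfold, rule \<phi>m, measurable)
  \<comment> \<open>Substituting \<open>x - \<alpha> *\<^sub>R \<nu>\<close> for \<open>x\<close>
    lowers the height by \<open>\<alpha>\<close>, because the normal has length 1.\<close>
  also have "\<dots> = (\<integral>\<^sup>+\<alpha>. \<integral>\<^sup>+x. \<phi> x (x \<bullet> \<nu> - \<alpha>) \<partial>lborel \<partial>lborel)"
  proof (rule nn_integral_cong)
    fix \<alpha> :: real
    have "(\<integral>\<^sup>+x. \<phi> (x + \<alpha> *\<^sub>R \<nu>) (x \<bullet> \<nu>) \<partial>lborel) =
        (\<integral>\<^sup>+x. \<phi> (x + \<alpha> *\<^sub>R \<nu>) (x \<bullet> \<nu>) \<partial>distr lborel borel ((+) (- \<alpha> *\<^sub>R \<nu>)))"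
      by (simp only: lborel_distr_plus)
    also have "\<dots> = (\<integral>\<^sup>+x. \<phi> x (x \<bullet> \<nu> - \<alpha>) \<partial>lborel)"
      by (subst nn_integral_distr) (auto intro!: \<phi>m simp: inner_diff_left \<nu> algebra_simps)
    finally show "(\<integral>\<^sup>+x. \<phi> (x + \<alpha> *\<^sub>R \<nu>) (x \<bullet> \<nu>) \<partial>lborel) = (\<integral>\<^sup>+x. \<phi> x (x \<bullet> \<nu> - \<alpha>) \<partial>lborel)" .
  qed
  also have "\<dots> = (\<integral>\<^sup>+x. \<integral>\<^sup>+\<alpha>. \<phi> x (x \<bullet> \<nu> - \<alpha>) \<partial>lborel \<partial>lborel)"
    by (rule lborel_pair.Fubini'[symmetric, symmetric]) (unfold case_prod_unfold, rule \<phi>m, measurable)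
  also have "\<dots> = (\<integral>\<^sup>+x. \<integral>\<^sup>+s. \<phi> x s \<partial>lborel \<partial>lborel)"
  proof (rule nn_integral_cong)
    fix x
    show "(\<integral>\<^sup>+\<alpha>. \<phi> x (x \<bullet> \<nu> - \<alpha>) \<partial>lborel) = (\<integral>\<^sup>+s. \<phi> x s \<partial>lborel)"
      by (subst (2) nn_integral_real_affine[where c="-1" and t="x \<bullet> \<nu>"]) (auto intro!: \<phi>m)
  qed
  finally show ?thesis .
qed

text \<open>A null set times the line is null, and the coordinate swap preserves measure. This
  carries an almost everywhere equality of functions over to almost every fibre.\<close>

lemma AE_swap_coordinate:
  fixes \<nu> :: "'a::euclidean_space"
  assumes "AE x in lborel. P x" and \<nu>: "\<nu> \<bullet> \<nu> = 1"
  shows "AE x in lborel. AE \<alpha> in lborel. P (x + (\<alpha> - x \<bullet> \<nu>) *\<^sub>R \<nu>)"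
proof -
  obtain N where N: "N \<in> null_sets lborel" "{x. \<not> P x} \<subseteq> N"
    using AE_E[OF assms(1)] by (auto simp: null_sets_def)
  then have [measurable]: "N \<in> sets borel" by (auto simp: null_sets_def)
  have [measurable]: "(\<lambda>x. x + (\<alpha> - x \<bullet> \<nu>) *\<^sub>R \<nu>) \<in> borel_measurable borel" for \<alpha> by measurable
  have "(\<integral>\<^sup>+x. \<integral>\<^sup>+\<alpha>. indicator N (x + (\<alpha> - x \<bullet> \<nu>) *\<^sub>R \<nu>) \<partial>lborel \<partial>lborel) =
      (\<integral>\<^sup>+x. \<integral>\<^sup>+s. indicator N x \<partial>(lborel :: real measure) \<partial>lborel)"
    using \<nu> by (intro nn_integral_swap_coordinate[where \<phi>="\<lambda>x s. indicator N x"]) measurable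
  \<comment> \<open>The inner integral is infinite on \<open>N\<close> and zero elsewhere.\<close>
  also have "\<dots> = (\<integral>\<^sup>+x. \<integral>\<^sup>+s. 0 \<partial>(lborel :: real measure) \<partial>(lborel :: 'a measure))"
    by (rule nn_integral_cong_AE) (use AE_not_in[OF N(1)] in \<open>auto elim!: eventually_mono\<close>)
  finally have zero: "(\<integral>\<^sup>+x. \<integral>\<^sup>+\<alpha>. indicator N (x + (\<alpha> - x \<bullet> \<nu>) *\<^sub>R \<nu>) \<partial>lborel \<partial>lborel) = (0::ennreal)"
    by simp
  have "(\<lambda>(x, \<alpha>). indicator N (x + (\<alpha> - x \<bullet> \<nu>) *\<^sub>R \<nu>) :: ennreal) \<in> borel_measurable (borel \<Otimes>\<^sub>M lborel)"
    by measurable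
  then have "(\<lambda>x. \<integral>\<^sup>+\<alpha>. indicator N (x + (\<alpha> - x \<bullet> \<nu>) *\<^sub>R \<nu>) \<partial>lborel :: ennreal) \<in> borel_measurable lborel"
    unfolding measurable_lborel2 by (rule lborel.borel_measurable_nn_integral)
  from nn_integral_0_iff_AE[OF this] zero
  have "AE x in lborel. (\<integral>\<^sup>+\<alpha>. indicator N (x + (\<alpha> - x \<bullet> \<nu>) *\<^sub>R \<nu>) \<partial>lborel) = (0::ennreal)"
    by blast
  then show ?thesis
  proof (rule eventually_mono)
    fix x
    assume "(\<integral>\<^sup>+\<alpha>. indicator N (x + (\<alpha> - x \<bullet> \<nu>) *\<^sub>R \<nu>) \<partial>lborel) = 0"
    then have "AE \<alpha> in lborel. indicator N (x + (\<alpha> - x \<bullet> \<nu>) *\<^sub>R \<nu>) = (0::ennreal)"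
      by (subst (asm) nn_integral_0_iff_AE) auto
    then show "AE \<alpha> in lborel. P (x + (\<alpha> - x \<bullet> \<nu>) *\<^sub>R \<nu>)"
      by (rule eventually_mono) (use N(2) in \<open>auto split: split_indicator_asm\<close>)
  qed
qed

text \<open>Without \<open>0 < u\<close> all negative numbers would count, since
  \<open>ennreal\<close> sends them to 0.\<close>

lemma nn_integral_indicator_below:
  "(\<integral>\<^sup>+u. indicator {u. 0 < u \<and> ennreal u \<le> c} u \<partial>lborel) = c"
proof (cases c)
  case (real r)
  then have "{u. 0 < u \<and> ennreal u \<le> c} = {0<..r}" by (auto simp: ennreal_le_iff)
  with real show ?thesis by simp
next
  case top
  then have "{u. 0 < u \<and> ennreal u \<le> c} = {0<..}" by auto
  moreover have "emeasure lborel {0::real<..} = top"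
  proof (rule ccontr)
    assume "emeasure lborel {0::real<..} \<noteq> top"
    then obtain n :: nat where "emeasure lborel {0::real<..} < of_nat n"
      using ennreal_Ex_less_of_nat by (auto simp: top.not_eq_extremum)
    moreover have "emeasure lborel {0::real<..real n} \<le> emeasure lborel {0::real<..}"
      by (intro emeasure_mono) auto
    ultimately show False by (simp add: ennreal_of_nat_eq_real_of_nat)
  qed
  ultimately show ?thesis using top by simp
qed

lemma long_fibre_mass_antimono:
  assumes "u \<le> v"
  shows "long_fibre_mass \<nu> f v \<le> long_fibre_mass \<nu> f u"
  unfolding long_fibre_mass_def
proof (intro nn_integral_mono mult_left_mono)
  have "long_fibre_set \<nu> f v \<subseteq> long_fibre_set \<nu> f u"
    using ennreal_leI[OF assms] by (auto simp: long_fibre_set_def intro: order_trans)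
  then show "indicator (long_fibre_set \<nu> f v) x \<le> (indicator (long_fibre_set \<nu> f u) x :: ennreal)" for x
    by (auto split: split_indicator)
qed auto

text \<open>Integrating over u first produces the fibre length; the coordinate swap then gives the
  weighted region below the graph of f, and the layer cake its integral. Fubini needs a Borel
  representative \<open>f'\<close>, whose fibre lengths agree with those of f at almost every point.
  The indicator removes negative u, where the mass keeps its value at 0.\<close>

lemma long_fibre_mass_Fubini:
  fixes f :: "'a::euclidean_space \<Rightarrow> ennreal"
  assumes f: "log_concave_ext f" and \<nu>: "\<nu> \<bullet> \<nu> = 1"
  shows "(\<lambda>u. long_fibre_mass \<nu> f u * indicator {0..} u) \<in> borel_measurable borel" (is ?meas)
    and "(\<integral>\<^sup>+u. long_fibre_mass \<nu> f u * indicator {0..} u \<partial>lborel) = (\<integral>\<^sup>+x. f x \<partial>lborel)" (is ?int)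
proof -
  obtain f' where f'[measurable]: "f' \<in> borel_measurable borel" and ff': "AE x in lborel. f x = f' x"
    using completion_ex_borel_measurable[OF log_concave_ext_measurable[OF f]] by auto
  define L where "L x = emeasure lborel (fibre \<nu> f' x)" for x
  have pair: "{p \<in> space (borel \<Otimes>\<^sub>M lborel). snd p \<in> fibre \<nu> f' (fst p)} \<in> sets (borel \<Otimes>\<^sub>M lborel)"
    unfolding fibre_def mem_Collect_eq by measurable
  have L[measurable]: "L \<in> borel_measurable borel"
    using lborel.measurable_emeasure_Pair[OF pair]
    by (simp add: L_def[abs_def] space_pair_measure vimage_def)
  have [measurable]: "fibre \<nu> f' x \<in> sets borel" for x
    unfolding fibre_def by measurable
  have AE_L: "AE x in lborel. emeasure lborel (fibre \<nu> f x) = L x"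
    using AE_swap_coordinate[OF ff' \<nu>]
  proof (rule eventually_mono)
    fix x assume "AE \<alpha> in lborel. f (x + (\<alpha> - x \<bullet> \<nu>) *\<^sub>R \<nu>) = f' (x + (\<alpha> - x \<bullet> \<nu>) *\<^sub>R \<nu>)"
    then have "AE \<alpha> in lborel. \<alpha> \<in> fibre \<nu> f x \<longleftrightarrow> \<alpha> \<in> fibre \<nu> f' x"
      by (rule eventually_mono) (simp add: fibre_def)
    then show "emeasure lborel (fibre \<nu> f x) = L x"
      unfolding L_def by (intro emeasure_eq_AE) (auto simp: fibre_borel[OF f])
  qed
  define a where "a u = (\<integral>\<^sup>+x. ennreal (exp (x \<bullet> \<nu>)) * indicator {u. 0 < u \<and> ennreal u \<le> L x} u \<partial>lborel)" for u
  have a: "long_fibre_mass \<nu> f u = a u" if "0 < u" for u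
    unfolding long_fibre_mass_def a_def
    using AE_L
  proof (intro nn_integral_cong_AE, elim eventually_mono)
    fix x assume L: "emeasure lborel (fibre \<nu> f x) = L x"
    have "x \<in> long_fibre_set \<nu> f u \<longleftrightarrow> 0 < u \<and> ennreal u \<le> L x"
      using that L by (auto simp: long_fibre_set_def)
    then show "ennreal (exp (x \<bullet> \<nu>)) * indicator (long_fibre_set \<nu> f u) x =
        ennreal (exp (x \<bullet> \<nu>)) * indicator {u. 0 < u \<and> ennreal u \<le> L x} u"
      by (simp add: indicator_def)
  qed
  have a0: "a u = 0" if "u \<le> 0" for u
    using that by (simp add: a_def)
  have pair2: "(\<lambda>p. ennreal (exp (fst p \<bullet> \<nu>)) * indicator {u. 0 < u \<and> ennreal u \<le> L (fst p)} (snd p))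
      \<in> borel_measurable (borel \<Otimes>\<^sub>M borel)"
  proof -
    have "{p \<in> space (borel \<Otimes>\<^sub>M borel). 0 < snd p \<and> ennreal (snd p) \<le> L (fst p)} \<in> sets (borel \<Otimes>\<^sub>M borel)"
      by measurable
    then have [measurable]: "{p. 0 < snd p \<and> ennreal (snd p) \<le> L (fst p)} \<in> sets (borel \<Otimes>\<^sub>M borel)"
      by (simp add: space_pair_measure)
    have "(\<lambda>p. ennreal (exp (fst p \<bullet> \<nu>)) * indicator {p. 0 < snd p \<and> ennreal (snd p) \<le> L (fst p)} p)
      \<in> borel_measurable (borel \<Otimes>\<^sub>M borel)" by measurable
    then show ?thesis by (simp add: indicator_def)
  qed
  have [measurable]: "a \<in> borel_measurable borel"
  proof -
    have "(\<lambda>p. ennreal (exp (snd p \<bullet> \<nu>)) * indicator {u. 0 < u \<and> ennreal u \<le> L (snd p)} (fst p))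
      \<in> borel_measurable (borel \<Otimes>\<^sub>M lborel)"
      using measurable_compose[OF measurable_pair_swap' pair2] by (simp add: case_prod_unfold)
    then show ?thesis
      unfolding a_def by (intro lborel.borel_measurable_nn_integral) (simp add: case_prod_unfold)
  qed
  \<comment> \<open>Nonemptiness of a fibre, unlike its length, is sensitive to null sets, so u = 0
    is kept apart; one point affects neither measurability nor integral.\<close>
  have eq: "long_fibre_mass \<nu> f u * indicator {0..} u = (if u = 0 then long_fibre_mass \<nu> f 0 else a u)" for u
    using a[of u] a0[of u] by (auto simp: indicator_def)
  show ?meas unfolding eq by measurable
  have "(\<integral>\<^sup>+u. long_fibre_mass \<nu> f u * indicator {0..} u \<partial>lborel) = (\<integral>\<^sup>+u. a u \<partial>lborel)"
    unfolding eq
    by (intro nn_integral_cong_AE, use AE_lborel_singleton[of "0::real"] in eventually_elim) simp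
  also have "\<dots> = (\<integral>\<^sup>+x. \<integral>\<^sup>+u. ennreal (exp (x \<bullet> \<nu>)) * indicator {u. 0 < u \<and> ennreal u \<le> L x} u \<partial>lborel \<partial>lborel)"
    unfolding a_def using pair2 by (intro lborel_pair.Fubini') (simp add: case_prod_unfold)
  also have "\<dots> = (\<integral>\<^sup>+x. ennreal (exp (x \<bullet> \<nu>)) * L x \<partial>lborel)"
  proof (rule nn_integral_cong)
    fix x
    show "(\<integral>\<^sup>+u. ennreal (exp (x \<bullet> \<nu>)) * indicator {u. 0 < u \<and> ennreal u \<le> L x} u \<partial>lborel) = ennreal (exp (x \<bullet> \<nu>)) * L x"
      by (subst nn_integral_cmult) (auto simp: nn_integral_indicator_below)
  qed
  also have "\<dots> = (\<integral>\<^sup>+x. \<integral>\<^sup>+\<alpha>. ennreal (exp (x \<bullet> \<nu>)) *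
      indicator {s. ennreal (exp s) < f' (x + (\<alpha> - x \<bullet> \<nu>) *\<^sub>R \<nu>)} (x \<bullet> \<nu>) \<partial>lborel \<partial>lborel)"
  proof (rule nn_integral_cong)
    fix x
    have "ennreal (exp (x \<bullet> \<nu>)) * L x = (\<integral>\<^sup>+\<alpha>. ennreal (exp (x \<bullet> \<nu>)) * indicator (fibre \<nu> f' x) \<alpha> \<partial>lborel)"
      by (simp add: L_def nn_integral_cmult)
    then show "ennreal (exp (x \<bullet> \<nu>)) * L x = (\<integral>\<^sup>+\<alpha>. ennreal (exp (x \<bullet> \<nu>)) *
        indicator {s. ennreal (exp s) < f' (x + (\<alpha> - x \<bullet> \<nu>) *\<^sub>R \<nu>)} (x \<bullet> \<nu>) \<partial>lborel)"
      by (simp add: fibre_def indicator_def)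
  qed
  also have "\<dots> = (\<integral>\<^sup>+x. \<integral>\<^sup>+s. ennreal (exp s) * indicator {s. ennreal (exp s) < f' x} s \<partial>lborel \<partial>lborel)"
  proof (rule nn_integral_swap_coordinate[OF _ \<nu>])
    have "{p \<in> space (borel \<Otimes>\<^sub>M borel). ennreal (exp (snd p)) < f' (fst p)} \<in> sets (borel \<Otimes>\<^sub>M borel)"
      by measurable
    then have [measurable]: "{p. ennreal (exp (snd p)) < f' (fst p)} \<in> sets (borel \<Otimes>\<^sub>M borel)"
      by (simp add: space_pair_measure)
    have "(\<lambda>p. ennreal (exp (snd p)) * indicator {p. ennreal (exp (snd p)) < f' (fst p)} p)
        \<in> borel_measurable (borel \<Otimes>\<^sub>M borel)"
      by measurable
    then show "(\<lambda>(x, s). ennreal (exp s) * indicator {s. ennreal (exp s) < f' x} s)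
        \<in> borel_measurable (borel \<Otimes>\<^sub>M borel)"
      by (simp add: case_prod_unfold indicator_def)
  qed
  also have "\<dots> = (\<integral>\<^sup>+x. f x \<partial>lborel)"
    using ff' by (simp add: layer_cake_exp) (auto intro!: nn_integral_cong_AE elim!: eventually_mono)
  finally show ?int .
qed

lemma linear_prekopa_leindler:
  fixes f g h :: "'a::euclidean_space \<Rightarrow> ennreal"
  assumes lc: "log_concave_ext f" "log_concave_ext g" "log_concave_ext h" and t: "0 < t" "t < 1"
    and le: "\<And>x y. log_mean_less t (f x) (g y) (h ((1 - t) *\<^sub>R x + t *\<^sub>R y))"
    and \<nu>: "\<nu> \<bullet> \<nu> = 1"
    and eq: "long_fibre_mass \<nu> f 0 = long_fibre_mass \<nu> g 0"
  shows "ennreal (1 - t) * (\<integral>\<^sup>+x. f x \<partial>lborel) + ennreal t * (\<integral>\<^sup>+x. g x \<partial>lborel) \<le> (\<integral>\<^sup>+x. h x \<partial>lborel)"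
proof -
  have sup: "(SUP u. long_fibre_mass \<nu> k u * indicator {0..} u) = long_fibre_mass \<nu> k 0" for k
  proof (rule antisym)
    show "(SUP u. long_fibre_mass \<nu> k u * indicator {0..} u) \<le> long_fibre_mass \<nu> k 0"
      by (intro SUP_least) (auto simp: indicator_def long_fibre_mass_antimono)
    show "long_fibre_mass \<nu> k 0 \<le> (SUP u. long_fibre_mass \<nu> k u * indicator {0..} u)"
      by (rule SUP_upper2[of 0]) auto
  qed
  have "ennreal (1 - t) * (\<integral>\<^sup>+u. long_fibre_mass \<nu> f u * indicator {0..} u \<partial>lborel) +
      ennreal t * (\<integral>\<^sup>+u. long_fibre_mass \<nu> g u * indicator {0..} u \<partial>lborel)
      \<le> (\<integral>\<^sup>+u. long_fibre_mass \<nu> h u * indicator {0..} u \<partial>lborel)"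
  proof (rule log_mean_integral_real_equal_sup)
    fix s u v
    assume uv: "ennreal (exp s) < long_fibre_mass \<nu> f u * indicator {0..} u"
      "ennreal (exp s) < long_fibre_mass \<nu> g v * indicator {0..} v"
    then have pos: "0 \<le> u" "0 \<le> v" by (auto split: split_indicator_asm)
    have "log_mean_less t (long_fibre_mass \<nu> f u) (long_fibre_mass \<nu> g v)
        (long_fibre_mass \<nu> h ((1 - t) * u + t * v))"
      unfolding long_fibre_mass_def
      using pos lc t le
      by (intro prekopa_leindler_exp_weight convex_lebesgue long_fibre_set_convex
          long_fibre_set_convex_comb) auto
    moreover have "ennreal (exp s) < long_fibre_mass \<nu> f u" "ennreal (exp s) < long_fibre_mass \<nu> g v"
      using uv pos by auto
    \<comment> \<open>Only the case of equal levels p = q = s is used.\<close>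
    ultimately have "ennreal (exp ((1 - t) * s + t * s)) < long_fibre_mass \<nu> h ((1 - t) * u + t * v)"
      unfolding log_mean_less_def by blast
    moreover have "(1 - t) * s + t * s = s" by (simp add: algebra_simps)
    ultimately show "ennreal (exp s) <
        long_fibre_mass \<nu> h ((1 - t) * u + t * v) * indicator {0..} ((1 - t) * u + t * v)"
      using pos t by simp
  qed (use long_fibre_mass_Fubini(1)[OF _ \<nu>] lc t in \<open>simp_all add: sup eq\<close>)
  then show ?thesis
    by (simp add: long_fibre_mass_Fubini(2)[OF lc(1) \<nu>] long_fibre_mass_Fubini(2)[OF lc(2) \<nu>]
        long_fibre_mass_Fubini(2)[OF lc(3) \<nu>])
qed

section \<open>Orthonormal coordinates\<close>

lemma orthonormal_inner:
  assumes "is_orthonormal_basis H B" "b \<in> B" "c \<in> B"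
  shows "b \<bullet> c = (if b = c then 1 else 0)"
  using assms by (auto simp: is_orthonormal_basis_def pairwise_def orthogonal_def dot_square_norm)

lemma orthonormal_basis_independent:
  assumes "is_orthonormal_basis H B"
  shows "independent B"
  using assms by (intro pairwise_orthogonal_independent) (auto simp: is_orthonormal_basis_def)

text \<open>Integrating \<open>(x, y) \<mapsto> indicator A (T x + y) * indicator (ball 0 1) y\<close> in both orders compares the
  two translation-invariant measures, and the unit ball fixes the constant.\<close>

lemma distr_lborel_orthogonal_transformation:
  fixes T :: "'a::euclidean_space \<Rightarrow> 'a"
  assumes T: "orthogonal_transformation T"
  shows "distr lborel borel T = lborel"
proof (rule measure_eqI)
  have lin: "linear T" using T by (rule orthogonal_transformation_linear)
  then have [measurable]: "T \<in> borel_measurable borel"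
    by (intro borel_measurable_continuous_onI linear_continuous_on linear_conv_bounded_linear[THEN iffD1])
  fix A assume "A \<in> sets (distr lborel borel T)"
  then have [measurable]: "A \<in> sets borel" by simp
  define \<phi> where "\<phi> x y = (indicator A (T x + y) * indicator (ball 0 1) y :: ennreal)" for x y
  have shift: "(\<integral>\<^sup>+x. g x \<partial>lborel) = (\<integral>\<^sup>+x. g (c + x) \<partial>lborel)"
    if [measurable]: "g \<in> borel_measurable borel" for g :: "'a \<Rightarrow> ennreal" and c
  proof -
    have "(\<integral>\<^sup>+x. g x \<partial>lborel) = (\<integral>\<^sup>+x. g x \<partial>distr lborel borel ((+) c))"
      by (simp only: lborel_distr_plus)
    then show ?thesis by (simp add: nn_integral_distr)
  qed
  have [measurable]: "ball (0::'a) 1 \<in> sets borel" by simp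
  have "(\<integral>\<^sup>+y. \<integral>\<^sup>+x. \<phi> x y \<partial>lborel \<partial>lborel) =
      (\<integral>\<^sup>+y. emeasure (distr lborel borel T) A * indicator (ball (0::'a) 1) y \<partial>lborel)"
  proof (rule nn_integral_cong)
    fix y
    obtain c where c: "y = T c" using orthogonal_transformation_surj[OF T] by (metis surjD)
    have "(\<integral>\<^sup>+x. \<phi> x y \<partial>lborel) = (\<integral>\<^sup>+x. indicator A (T x + y) \<partial>lborel) * indicator (ball 0 1) y"
      unfolding \<phi>_def by (rule nn_integral_multc) measurable
    also have "(\<integral>\<^sup>+x. indicator A (T x + y) \<partial>lborel) = (\<integral>\<^sup>+x. indicator A (T (c + x)) \<partial>lborel)"
      by (simp add: c linear_add[OF lin] add.commute)
    also have "\<dots> = (\<integral>\<^sup>+x. indicator A (T x) \<partial>lborel)"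
      by (rule shift[symmetric]) measurable
    also have "\<dots> = emeasure (distr lborel borel T) A"
      using nn_integral_distr[of T lborel borel "indicator A"] by simp
    finally show "(\<integral>\<^sup>+x. \<phi> x y \<partial>lborel) = emeasure (distr lborel borel T) A * indicator (ball 0 1) y" .
  qed
  then have 1: "(\<integral>\<^sup>+y. \<integral>\<^sup>+x. \<phi> x y \<partial>lborel \<partial>lborel) = emeasure (distr lborel borel T) A * emeasure lborel (ball (0::'a) 1)"
    by (simp add: nn_integral_cmult)
  have "(\<integral>\<^sup>+y. \<integral>\<^sup>+x. \<phi> x y \<partial>lborel \<partial>lborel) = (\<integral>\<^sup>+x. \<integral>\<^sup>+y. \<phi> x y \<partial>lborel \<partial>lborel)"
    by (rule lborel_pair.Fubini') (unfold \<phi>_def, measurable)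
  also have "\<dots> = (\<integral>\<^sup>+x. \<integral>\<^sup>+y. indicator A y * indicator (ball 0 1) (y - T x) \<partial>lborel \<partial>lborel)"
  proof (rule nn_integral_cong)
    fix x
    show "(\<integral>\<^sup>+y. \<phi> x y \<partial>lborel) = (\<integral>\<^sup>+y. indicator A y * indicator (ball 0 1) (y - T x) \<partial>lborel)"
      unfolding \<phi>_def by (subst (2) shift[where c="T x"]) auto
  qed
  also have "\<dots> = (\<integral>\<^sup>+y. \<integral>\<^sup>+x. indicator A y * indicator (ball 0 1) (y - T x) \<partial>lborel \<partial>lborel)"
    by (rule lborel_pair.Fubini'[symmetric]) measurable
  also have "\<dots> = (\<integral>\<^sup>+y. indicator A y * emeasure lborel (ball (0::'a) 1) \<partial>lborel)"
  proof (rule nn_integral_cong)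
    fix y
    obtain c where c: "y = T c" using orthogonal_transformation_surj[OF T] by (metis surjD)
    \<comment> \<open>Norm preservation enters here: the preimage of a unit ball is a unit ball,
      whose volume does not depend on its centre.\<close>
    have ball: "indicator (ball 0 1) (y - T x) = (indicator (ball c 1) x :: ennreal)" for x
      using T by (simp add: c indicator_def dist_norm linear_diff[OF lin, symmetric] orthogonal_transformation)
    have "(\<integral>\<^sup>+x. indicator A y * indicator (ball 0 1) (y - T x) \<partial>lborel) = indicator A y * emeasure lborel (ball c 1)"
      unfolding ball by (rule nn_integral_cmult_indicator) simp
    then show "(\<integral>\<^sup>+x. indicator A y * indicator (ball 0 1) (y - T x) \<partial>lborel) =
        indicator A y * emeasure lborel (ball (0::'a) 1)"
      by (simp add: emeasure_ball)
  qed
  also have "\<dots> = emeasure lborel A * emeasure lborel (ball (0::'a) 1)"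
    by (simp add: nn_integral_multc)
  finally have "emeasure (distr lborel borel T) A * emeasure lborel (ball (0::'a) 1) =
      emeasure lborel A * emeasure lborel (ball (0::'a) 1)"
    using 1 by simp
  moreover have "emeasure lborel (ball (0::'a) 1) \<noteq> 0" "emeasure lborel (ball (0::'a) 1) \<noteq> top"
    using unit_ball_vol_pos[of "real DIM('a)", OF of_nat_0_le_iff]
    by (simp_all add: emeasure_ball del: unit_ball_vol_pos)
  ultimately show "emeasure (distr lborel borel T) A = emeasure lborel A"
    by (simp add: mult.commute[of _ "emeasure lborel (ball 0 1)"] ennreal_mult_cancel_left)
qed simp

text \<open>Serves to pass between coordinates indexed by the standard basis and by another
  orthonormal basis.\<close>

lemma distr_PiM_lborel_reindex:
  assumes "finite I" and \<sigma>: "bij_betw \<sigma> I J"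
  shows "distr (Pi\<^sub>M I (\<lambda>_. lborel)) (Pi\<^sub>M J (\<lambda>_. lborel)) (\<lambda>\<omega>. \<lambda>j\<in>J. \<omega> (the_inv_into I \<sigma> j)) =
    Pi\<^sub>M J (\<lambda>_. lborel :: real measure)"
proof (rule lborel_PiM.PiM_eqI)
  let ?\<tau> = "the_inv_into I \<sigma>"
  have \<tau>: "?\<tau> j \<in> I" "\<sigma> (?\<tau> j) = j" if "j \<in> J" for j
    using \<sigma> that by (auto simp: bij_betw_def f_the_inv_into_f intro: the_inv_into_into)
  have \<tau>\<sigma>: "\<sigma> i \<in> J" "?\<tau> (\<sigma> i) = i" if "i \<in> I" for i
    using \<sigma> that by (auto simp: bij_betw_def the_inv_into_f_f)
  show "finite J" using assms by (metis bij_betw_finite)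
  have [measurable]: "(\<lambda>\<omega>. \<lambda>j\<in>J. \<omega> (?\<tau> j)) \<in> Pi\<^sub>M I (\<lambda>_. lborel) \<rightarrow>\<^sub>M Pi\<^sub>M J (\<lambda>_. lborel :: real measure)"
    by (intro measurable_restrict measurable_component_singleton \<tau>)
  fix A :: "'b \<Rightarrow> real set" assume A: "\<And>j. j \<in> J \<Longrightarrow> A j \<in> sets lborel"
  have "(\<lambda>\<omega>. \<lambda>j\<in>J. \<omega> (?\<tau> j)) -` (Pi\<^sub>E J A) \<inter> space (Pi\<^sub>M I (\<lambda>_. lborel)) = Pi\<^sub>E I (\<lambda>i. A (\<sigma> i))"
    using \<tau> \<tau>\<sigma> by (fastforce simp: space_PiM PiE_iff extensional_def)
  then have "emeasure (distr (Pi\<^sub>M I (\<lambda>_. lborel)) (Pi\<^sub>M J (\<lambda>_. lborel)) (\<lambda>\<omega>. \<lambda>j\<in>J. \<omega> (?\<tau> j))) (Pi\<^sub>E J A) =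
      emeasure (Pi\<^sub>M I (\<lambda>_. lborel)) (Pi\<^sub>E I (\<lambda>i. A (\<sigma> i)))"
    using A \<open>finite J\<close> by (subst emeasure_distr) (auto intro!: sets_PiM_I_finite)
  also have "\<dots> = (\<Prod>i\<in>I. emeasure lborel (A (\<sigma> i)))"
    using A \<tau>\<sigma> \<open>finite I\<close> by (intro lborel_PiM.emeasure_PiM) auto
  also have "\<dots> = (\<Prod>j\<in>J. emeasure lborel (A j))"
    using \<sigma> by (rule prod.reindex_bij_betw)
  finally show "emeasure (distr (Pi\<^sub>M I (\<lambda>_. lborel)) (Pi\<^sub>M J (\<lambda>_. lborel)) (\<lambda>\<omega>. \<lambda>j\<in>J. \<omega> (?\<tau> j))) (Pi\<^sub>E J A) =
      (\<Prod>j\<in>J. emeasure lborel (A j))" .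
qed simp

text \<open>A bijection from the standard basis to \<open>B\<close> extends to an orthogonal map,
  which preserves \<open>lborel\<close>; in coordinates this map is just a reindexing.\<close>

lemma lborel_orthonormal_coordinates:
  fixes B :: "'a::euclidean_space set"
  assumes B: "is_orthonormal_basis UNIV B"
  shows "lborel = distr (Pi\<^sub>M B (\<lambda>_. lborel)) borel (\<lambda>c. \<Sum>b\<in>B. c b *\<^sub>R b)"
proof -
  note ind = orthonormal_basis_independent[OF B]
  have fin: "finite B" using ind by (rule independent_imp_finite)
  have "card B = dim (UNIV :: 'a set)"
    using B ind by (metis dim_span_eq_card_independent is_orthonormal_basis_def)
  then obtain \<sigma> :: "'a \<Rightarrow> 'a" where \<sigma>: "bij_betw \<sigma> Basis B"
    using fin by (metis dim_UNIV finite_Basis finite_same_card_bij)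
  define T where "T x = (\<Sum>i\<in>Basis. (x \<bullet> i) *\<^sub>R \<sigma> i)" for x
  have inner: "\<sigma> i \<bullet> \<sigma> j = (if i = j then 1 else 0)" if "i \<in> Basis" "j \<in> Basis" for i j
    using orthonormal_inner[OF B, of "\<sigma> i" "\<sigma> j"] \<sigma> that by (auto simp: bij_betw_def inj_on_eq_iff)
  have T: "orthogonal_transformation T"
    unfolding orthogonal_transformation_def
  proof (intro conjI allI)
    show "linear T"
      unfolding T_def
      by (intro linear_compose_sum ballI linearI) (simp_all add: inner_add_left scaleR_add_left)
    fix v w
    have "T v \<bullet> T w = (\<Sum>i\<in>Basis. \<Sum>j\<in>Basis. (v \<bullet> i) * (w \<bullet> j) * (\<sigma> i \<bullet> \<sigma> j))"
      by (simp add: T_def inner_sum_left inner_sum_right mult.assoc sum_distrib_left)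
        (subst sum.swap, simp add: mult_ac)
    also have "\<dots> = (\<Sum>i\<in>Basis. (v \<bullet> i) * (w \<bullet> i))"
      by (intro sum.cong refl) (simp add: inner if_distrib sum.delta cong: sum.cong if_cong)
    also have "\<dots> = v \<bullet> w" by (rule euclidean_inner[symmetric])
    finally show "T v \<bullet> T w = v \<bullet> w" .
  qed
  have [measurable]: "T \<in> borel_measurable borel" unfolding T_def by measurable
  have [measurable]: "(\<lambda>c. \<Sum>b\<in>A. c b *\<^sub>R b) \<in> borel_measurable (Pi\<^sub>M A (\<lambda>_. lborel :: real measure))"
    for A :: "'a set" by measurable
  have \<tau>: "(\<lambda>\<omega>. \<lambda>j\<in>B. \<omega> (the_inv_into Basis \<sigma> j)) \<in> Pi\<^sub>M Basis (\<lambda>_. lborel) \<rightarrow>\<^sub>M Pi\<^sub>M B (\<lambda>_. lborel :: real measure)"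
    using \<sigma> by (intro measurable_restrict measurable_component_singleton the_inv_into_into)
      (auto simp: bij_betw_def)
  have "lborel = distr (lborel :: 'a measure) borel T"
    using distr_lborel_orthogonal_transformation[OF T] by simp
  also have "\<dots> = distr (distr (Pi\<^sub>M Basis (\<lambda>_. lborel)) borel (\<lambda>c. \<Sum>b\<in>Basis. c b *\<^sub>R b)) borel T"
    by (simp only: lborel_eq[symmetric])
  also have "\<dots> = distr (Pi\<^sub>M Basis (\<lambda>_. lborel)) borel (\<lambda>c. T (\<Sum>b\<in>Basis. c b *\<^sub>R b))"
    by (subst distr_distr) (auto simp: comp_def)
  also have "(\<lambda>c. T (\<Sum>b\<in>Basis. c b *\<^sub>R b)) =
      (\<lambda>c. \<Sum>b\<in>B. c b *\<^sub>R b) \<circ> (\<lambda>\<omega>. \<lambda>j\<in>B. \<omega> (the_inv_into Basis \<sigma> j))"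
  proof
    fix c :: "'a \<Rightarrow> real"
    have "T (\<Sum>b\<in>Basis. c b *\<^sub>R b) = (\<Sum>i\<in>Basis. c i *\<^sub>R \<sigma> i)"
      by (simp add: T_def)
    also have "\<dots> = (\<Sum>i\<in>Basis. (\<lambda>b. c (the_inv_into Basis \<sigma> b) *\<^sub>R b) (\<sigma> i))"
      using \<sigma> by (intro sum.cong) (auto simp: bij_betw_def the_inv_into_f_f)
    also have "\<dots> = (\<Sum>b\<in>B. c (the_inv_into Basis \<sigma> b) *\<^sub>R b)"
      using \<sigma> by (rule sum.reindex_bij_betw)
    finally show "T (\<Sum>b\<in>Basis. c b *\<^sub>R b) =
        ((\<lambda>c. \<Sum>b\<in>B. c b *\<^sub>R b) \<circ> (\<lambda>\<omega>. \<lambda>j\<in>B. \<omega> (the_inv_into Basis \<sigma> j))) c"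
      by simp
  qed
  also have "distr (Pi\<^sub>M Basis (\<lambda>_. lborel)) borel \<dots> =
      distr (distr (Pi\<^sub>M Basis (\<lambda>_. lborel)) (Pi\<^sub>M B (\<lambda>_. lborel)) (\<lambda>\<omega>. \<lambda>j\<in>B. \<omega> (the_inv_into Basis \<sigma> j)))
        borel (\<lambda>c. \<Sum>b\<in>B. c b *\<^sub>R b)"
    using \<tau> by (subst distr_distr) auto
  also have "\<dots> = distr (Pi\<^sub>M B (\<lambda>_. lborel)) borel (\<lambda>c. \<Sum>b\<in>B. c b *\<^sub>R b)"
    by (simp add: distr_PiM_lborel_reindex[OF finite_Basis \<sigma>])
  finally show ?thesis .
qed

section \<open>Splitting Lebesgue measure along a hyperplane\<close>

lemma orthonormal_basis_insert_normal:
  fixes H :: "'a::euclidean_space set"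
  assumes B: "is_orthonormal_basis H B" and H: "subspace H" "dim H = DIM('a) - 1" and \<nu>: "is_unit_normal H \<nu>"
  shows "\<nu> \<notin> B" "is_orthonormal_basis UNIV (insert \<nu> B)"
proof -
  have n: "\<nu> \<bullet> \<nu> = 1" and perp: "\<And>h. h \<in> H \<Longrightarrow> h \<bullet> \<nu> = 0"
    using \<nu> by (auto simp: is_unit_normal_def dot_square_norm)
  have BH: "B \<subseteq> H" "span B = H" using B by (auto simp: is_orthonormal_basis_def)
  have "\<nu> \<notin> H" using perp[of \<nu>] n by auto
  then show "\<nu> \<notin> B" using BH by auto
  have "dim B = dim H" using BH(2) by (metis dim_span)
  then have "dim (insert \<nu> B) = DIM('a)"
    using H BH \<open>\<nu> \<notin> H\<close> by (simp add: dim_insert)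
  then have "span (insert \<nu> B) = UNIV" by (simp add: dim_eq_full)
  moreover have "orthogonal \<nu> b" "orthogonal b \<nu>" if "b \<in> B" for b
    using perp[of b] that BH by (auto simp: orthogonal_def inner_commute)
  ultimately show "is_orthonormal_basis UNIV (insert \<nu> B)"
    using B \<nu> by (simp add: is_orthonormal_basis_def pairwise_insert is_unit_normal_def)
qed

lemma nn_integral_hyperplane_Fubini:
  fixes \<phi> :: "'a::euclidean_space \<Rightarrow> ennreal"
  assumes [measurable]: "\<phi> \<in> borel_measurable borel"
    and B: "is_orthonormal_basis H B" and H: "subspace H" "dim H = DIM('a) - 1" and \<nu>: "is_unit_normal H \<nu>"
  shows "(\<integral>\<^sup>+x. \<phi> x \<partial>lborel) =
    (\<integral>\<^sup>+c. \<integral>\<^sup>+s. \<phi> ((\<Sum>b\<in>B. c b *\<^sub>R b) + s *\<^sub>R \<nu>) \<partial>lborel \<partial>Pi\<^sub>M B (\<lambda>_. lborel))"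
proof -
  note ins = orthonormal_basis_insert_normal[OF B H \<nu>]
  have fin: "finite B"
    using orthonormal_basis_independent[OF B] by (rule independent_imp_finite)
  have [measurable]: "(\<lambda>c. \<Sum>b\<in>A. c b *\<^sub>R b) \<in> borel_measurable (Pi\<^sub>M A (\<lambda>_. lborel :: real measure))"
    for A :: "'a set" by measurable
  have "(\<integral>\<^sup>+x. \<phi> x \<partial>lborel) = (\<integral>\<^sup>+c. \<phi> (\<Sum>b\<in>insert \<nu> B. c b *\<^sub>R b) \<partial>Pi\<^sub>M (insert \<nu> B) (\<lambda>_. lborel))"
    by (subst lborel_orthonormal_coordinates[OF ins(2)]) (subst nn_integral_distr, auto)
  also have "\<dots> = (\<integral>\<^sup>+c. \<integral>\<^sup>+s. \<phi> (\<Sum>b\<in>insert \<nu> B. (c(\<nu> := s)) b *\<^sub>R b) \<partial>lborel \<partial>Pi\<^sub>M B (\<lambda>_. lborel))"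
    using fin ins(1) by (intro lborel_PiM.product_nn_integral_insert) auto
  also have "\<dots> = (\<integral>\<^sup>+c. \<integral>\<^sup>+s. \<phi> ((\<Sum>b\<in>B. c b *\<^sub>R b) + s *\<^sub>R \<nu>) \<partial>lborel \<partial>Pi\<^sub>M B (\<lambda>_. lborel))"
  proof -
    have "(\<Sum>b\<in>insert \<nu> B. (c(\<nu> := s)) b *\<^sub>R b) = (\<Sum>b\<in>B. c b *\<^sub>R b) + s *\<^sub>R \<nu>" for c s
      using fin ins(1) by (auto simp: add.commute intro!: sum.cong)
    then show ?thesis by simp
  qed
  finally show ?thesis .
qed

text \<open>Above a point h of the hyperplane, a fibre at height s is nonempty exactly when
  \<open>exp s\<close> is below the supremum along the normal, so the layer cake returns the
  projection. The set \<open>S\<close> need not be Borel; its interior replaces it, and the null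
  frontier has null slices above almost every h.\<close>

lemma long_fibre_mass_0_eq_proj:
  fixes f :: "'a::euclidean_space \<Rightarrow> ennreal"
  assumes f: "log_concave_ext f" and H: "subspace H" "dim H = DIM('a) - 1" and \<nu>: "is_unit_normal H \<nu>"
  shows "long_fibre_mass \<nu> f 0 = (\<integral>\<^sup>+x. proj_H H f x \<partial>subspace_lebesgue H)"
proof -
  \<comment> \<open>The very choice made in \<open>subspace_lebesgue\<close>, so that
    \<open>D\<close> below is that measure before completion.\<close>
  define B where "B = (SOME B. is_orthonormal_basis H B)"
  have B: "is_orthonormal_basis H B"
    unfolding B_def using is_orthonormal_basis_exists[OF H(1)] by (rule someI_ex)
  have perp: "h \<bullet> \<nu> = 0" if "h \<in> H" for h using \<nu> that by (auto simp: is_unit_normal_def)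
  have n: "\<nu> \<bullet> \<nu> = 1" using \<nu> by (auto simp: is_unit_normal_def dot_square_norm)
  define \<Psi> where "\<Psi> c = (\<Sum>b\<in>B. c b *\<^sub>R b)" for c :: "'a \<Rightarrow> real"
  have \<Psi>H: "\<Psi> c \<in> H" for c
    unfolding \<Psi>_def using B H(1)
    by (intro subspace_sum subspace_scale) (auto simp: is_orthonormal_basis_def)
  define D where "D = distr (Pi\<^sub>M B (\<lambda>_. lborel)) (restrict_space borel H) \<Psi>"
  have \<Psi>[measurable]: "\<Psi> \<in> Pi\<^sub>M B (\<lambda>_. lborel) \<rightarrow>\<^sub>M restrict_space borel H"
    using \<Psi>H unfolding \<Psi>_def by (intro measurable_restrict_space2) auto
  note Fub = nn_integral_hyperplane_Fubini[OF _ B H \<nu>, folded \<Psi>_def]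
  define S where "S = long_fibre_set \<nu> f 0"
  define G where "G h = (\<integral>\<^sup>+s. ennreal (exp s) * indicator (interior S) (h + s *\<^sub>R \<nu>) \<partial>lborel)" for h
  define K where "K h = (\<integral>\<^sup>+s. indicator (frontier S) (h + s *\<^sub>R \<nu>) \<partial>lborel :: ennreal)" for h
  have [measurable]: "interior S \<in> sets borel" "frontier S \<in> sets borel"
    by (simp_all add: borel_closed)
  have "(\<lambda>p. ennreal (exp (snd p)) * indicator (interior S) (fst p + snd p *\<^sub>R \<nu>)) \<in> borel_measurable (borel \<Otimes>\<^sub>M lborel)"
    "(\<lambda>p. indicator (frontier S) (fst p + snd p *\<^sub>R \<nu>) :: ennreal) \<in> borel_measurable (borel \<Otimes>\<^sub>M lborel)"
    by measurable
  then have [measurable]: "G \<in> borel_measurable borel" "K \<in> borel_measurable borel"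
    unfolding G_def K_def
    by (auto intro!: lborel.borel_measurable_nn_integral simp: case_prod_unfold)
  have "negligible (frontier S)"
    unfolding S_def using f by (intro negligible_convex_frontier long_fibre_set_convex) auto
  then have null: "frontier S \<in> null_sets lborel"
    by (simp add: negligible_iff_null_sets null_sets_completion_iff)
  have SF: "x \<in> S \<longleftrightarrow> x \<in> interior S" if "x \<notin> frontier S" for x
    using that interior_subset[of S] closure_subset[of S] by (auto simp: frontier_def)
  have "long_fibre_mass \<nu> f 0 = (\<integral>\<^sup>+x. ennreal (exp (x \<bullet> \<nu>)) * indicator (interior S) x \<partial>lborel)"
    unfolding long_fibre_mass_def S_def[symmetric]
    by (intro nn_integral_cong_AE, use AE_not_in[OF null] in eventually_elim)
       (simp add: SF indicator_def)
  also have "\<dots> = (\<integral>\<^sup>+c. G (\<Psi> c) \<partial>Pi\<^sub>M B (\<lambda>_. lborel))"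
    unfolding G_def by (subst Fub) (simp_all add: inner_add_left perp \<Psi>H n)
  also have "\<dots> = (\<integral>\<^sup>+x. G x \<partial>D)"
    unfolding D_def by (rule nn_integral_distr[symmetric, OF \<Psi>]) (simp add: measurable_restrict_space1)
  also have "\<dots> = (\<integral>\<^sup>+x. proj_H H f x \<partial>D)"
  proof (rule nn_integral_cong_AE)
    have "(\<integral>\<^sup>+c. K (\<Psi> c) \<partial>Pi\<^sub>M B (\<lambda>_. lborel)) = (\<integral>\<^sup>+x. indicator (frontier S) x \<partial>lborel)"
      unfolding K_def by (subst Fub) simp_all
    also have "\<dots> = 0" using null by (simp add: null_setsD1)
    finally have "(\<integral>\<^sup>+x. K x \<partial>D) = 0"
      unfolding D_def by (subst nn_integral_distr[OF \<Psi>]) (simp_all add: measurable_restrict_space1)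
    then have "AE x in D. K x = 0"
      by (subst (asm) nn_integral_0_iff_AE) (simp_all add: D_def measurable_restrict_space1)
    then show "AE x in D. G x = proj_H H f x"
      using AE_space[of D]
    proof eventually_elim
      fix x assume K: "K x = 0" and "x \<in> space D"
      then have xH: "x \<in> H" by (simp add: D_def space_restrict_space)
      define F where "F = (SUP \<alpha>::real. f (x + \<alpha> *\<^sub>R \<nu>))"
      have S: "x + s *\<^sub>R \<nu> \<in> S \<longleftrightarrow> ennreal (exp s) < F" for s
      proof -
        have "(x + s *\<^sub>R \<nu>) \<bullet> \<nu> = s" using perp[OF xH] n by (simp add: inner_add_left)
        then have "fibre \<nu> f (x + s *\<^sub>R \<nu>) = {\<alpha>. ennreal (exp s) < f (x + \<alpha> *\<^sub>R \<nu>)}"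
          by (simp add: fibre_def algebra_simps)
        then show ?thesis by (auto simp: S_def long_fibre_set_def F_def less_SUP_iff)
      qed
      have "AE s in lborel. indicator (frontier S) (x + s *\<^sub>R \<nu>) = (0::ennreal)"
        using K unfolding K_def by (subst (asm) nn_integral_0_iff_AE) auto
      then have "G x = (\<integral>\<^sup>+s. ennreal (exp s) * indicator {s. ennreal (exp s) < F} s \<partial>lborel)"
        unfolding G_def
        by (intro nn_integral_cong_AE, elim eventually_mono)
           (use SF S in \<open>auto simp: indicator_def split: if_splits\<close>)
      also have "\<dots> = F" by (rule layer_cake_exp)
      finally show "G x = proj_H H f x"
        using H \<nu> by (simp add: proj_H_eq F_def)
    qed
  qed
  also have "\<dots> = (\<integral>\<^sup>+x. proj_H H f x \<partial>subspace_lebesgue H)"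
    by (simp add: subspace_lebesgue_def B_def[symmetric] D_def \<Psi>_def[abs_def] nn_integral_completion)
  finally show ?thesis .
qed

section \<open>Asplund sums\<close>

text \<open>A value above \<open>exp p\<close> is positive, which forces the exponent to be finite
  there; convexity then becomes an inequality between reals.\<close>

lemma log_concave_ext_ennreal:
  assumes "log_concave f"
  shows "log_concave_ext (\<lambda>x. ennreal (f x))"
  unfolding log_concave_ext_def log_mean_less_def
proof (intro ballI allI impI)
  fix t :: real and x y p q
  assume t: "t \<in> {0<..<1}"
    and p: "ennreal (exp p) < ennreal (f x)" and q: "ennreal (exp q) < ennreal (f y)"
  obtain u where u: "ext_convex u" and f: "\<And>x. f x = exp_neg (u x)"
    using assms by (auto simp: log_concave_def)
  have finite: "\<exists>a. u x = ereal a \<and> p < - a" if "ennreal (exp p) < ennreal (f x)" for x p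
    using that u by (cases "u x") (auto simp: f exp_neg_def ext_convex_def ennreal_less_iff)
  obtain a b where a: "u x = ereal a" "p < - a" and b: "u y = ereal b" "q < - b"
    using finite[OF p] finite[OF q] by auto
  have "u ((1 - t) *\<^sub>R x + t *\<^sub>R y) \<le> ereal ((1 - t) * a + t * b)"
    using u t a(1) b(1) unfolding ext_convex_def by (metis plus_ereal.simps(1) times_ereal.simps(1))
  moreover have "u ((1 - t) *\<^sub>R x + t *\<^sub>R y) \<noteq> - \<infinity>" using u by (simp add: ext_convex_def)
  ultimately obtain c where c: "u ((1 - t) *\<^sub>R x + t *\<^sub>R y) = ereal c" "c \<le> (1 - t) * a + t * b"
    by (cases "u ((1 - t) *\<^sub>R x + t *\<^sub>R y)") auto
  have "(1 - t) * p + t * q < (1 - t) * (- a) + t * (- b)"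
    using a(2) b(2) t by (intro add_strict_mono mult_strict_left_mono) auto
  also have "\<dots> \<le> - c" using c(2) by simp
  finally show "ennreal (exp ((1 - t) * p + t * q)) < ennreal (f ((1 - t) *\<^sub>R x + t *\<^sub>R y))"
    by (simp add: f c(1) exp_neg_def ennreal_less_iff)
qed

lemma log_mean_less_asplund_sum:
  assumes t: "0 < t" "t < 1"
  shows "log_mean_less t (ennreal (f x)) (ennreal (g y)) (asplund_sum t f g ((1 - t) *\<^sub>R x + t *\<^sub>R y))"
  unfolding log_mean_less_def
proof (intro allI impI)
  fix p q assume "ennreal (exp p) < ennreal (f x)" "ennreal (exp q) < ennreal (g y)"
  then have "exp p < f x" "exp q < g y" by (simp_all add: ennreal_less_iff)
  then have "exp p powr (1 - t) * exp q powr t < f x powr (1 - t) * g y powr t"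
    using t by (intro mult_strict_mono' powr_less_mono2) auto
  then have "ennreal (exp ((1 - t) * p + t * q)) < ennreal (f x powr (1 - t) * g y powr t)"
    by (simp add: ennreal_less_iff powr_def exp_add)
  also have "\<dots> \<le> asplund_sum t f g ((1 - t) *\<^sub>R x + t *\<^sub>R y)"
    unfolding asplund_sum_def by (rule SUP_upper2[of "(x, y)"]) auto
  finally show "ennreal (exp ((1 - t) * p + t * q)) < asplund_sum t f g ((1 - t) *\<^sub>R x + t *\<^sub>R y)" .
qed

text \<open>Converse to \<open>log_mean_less_asplund_sum\<close>: a level below the supremum is
  beaten by some pair, and splits into levels beaten by each factor separately.\<close>

lemma asplund_sum_greaterD:
  assumes t: "0 < t" "t < 1" and nonneg: "\<And>x. 0 \<le> f x" "\<And>x. 0 \<le> g x"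
    and less: "ennreal (exp p) < asplund_sum t f g z"
  obtains x y p1 p2 where "z = (1 - t) *\<^sub>R x + t *\<^sub>R y" "p = (1 - t) * p1 + t * p2"
    "ennreal (exp p1) < ennreal (f x)" "ennreal (exp p2) < ennreal (g y)"
proof -
  obtain x y where z: "z = (1 - t) *\<^sub>R x + t *\<^sub>R y"
    and "ennreal (exp p) < ennreal (f x powr (1 - t) * g y powr t)"
    using less by (auto simp: asplund_sum_def less_SUP_iff)
  then have fg: "exp p < f x powr (1 - t) * g y powr t" by (simp add: ennreal_less_iff)
  then have "0 < f x powr (1 - t) * g y powr t" by (rule less_trans[rotated]) simp
  then have pos: "0 < f x" "0 < g y"
    using nonneg[of x] nonneg[of y] by (auto simp: zero_less_mult_iff order.order_iff_strict)
  \<comment> \<open>The logarithmic slack. Lowering both logarithms by \<open>d\<close> lowers their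
    weighted mean by exactly \<open>d\<close>, since the weights add up to 1.\<close>
  define d where "d = (1 - t) * ln (f x) + t * ln (g y) - p"
  have "exp p < exp ((1 - t) * ln (f x) + t * ln (g y))"
    using fg pos by (simp add: powr_def exp_add)
  then have d: "0 < d" by (simp add: d_def)
  have "exp (ln (f x) - d) < exp (ln (f x))" "exp (ln (g y) - d) < exp (ln (g y))"
    using d by simp_all
  then have "exp (ln (f x) - d) < f x" "exp (ln (g y) - d) < g y" using pos by simp_all
  moreover have "p = (1 - t) * (ln (f x) - d) + t * (ln (g y) - d)"
    by (simp add: d_def algebra_simps)
  ultimately show thesis
    using z by (intro that[of x y "ln (f x) - d" "ln (g y) - d"]) (simp_all add: ennreal_less_iff)
qed

text \<open>Convex combinations with weights t and k commute, for points and for logarithmic levels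
  alike.\<close>

lemma log_concave_ext_asplund_sum:
  assumes "log_concave f" "log_concave g" and t: "0 < t" "t < 1"
  shows "log_concave_ext (asplund_sum t f g)"
  unfolding log_concave_ext_def log_mean_less_def
proof (intro ballI allI impI)
  fix k :: real and z w p q
  assume k: "k \<in> {0<..<1}" and less: "ennreal (exp p) < asplund_sum t f g z" "ennreal (exp q) < asplund_sum t f g w"
  note nonneg = log_concave_nonneg[OF assms(1)] log_concave_nonneg[OF assms(2)]
  obtain x1 y1 p1 p2 where 1: "z = (1 - t) *\<^sub>R x1 + t *\<^sub>R y1" "p = (1 - t) * p1 + t * p2"
    "ennreal (exp p1) < ennreal (f x1)" "ennreal (exp p2) < ennreal (g y1)"
    using asplund_sum_greaterD[OF t nonneg less(1)] .
  obtain x2 y2 q1 q2 where 2: "w = (1 - t) *\<^sub>R x2 + t *\<^sub>R y2" "q = (1 - t) * q1 + t * q2"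
    "ennreal (exp q1) < ennreal (f x2)" "ennreal (exp q2) < ennreal (g y2)"
    using asplund_sum_greaterD[OF t nonneg less(2)] .
  have "ennreal (exp ((1 - k) * p1 + k * q1)) < ennreal (f ((1 - k) *\<^sub>R x1 + k *\<^sub>R x2))"
    "ennreal (exp ((1 - k) * p2 + k * q2)) < ennreal (g ((1 - k) *\<^sub>R y1 + k *\<^sub>R y2))"
    using log_concave_ext_ennreal[OF assms(1)] log_concave_ext_ennreal[OF assms(2)] k 1 2
    unfolding log_concave_ext_def log_mean_less_def by blast+
  then have "ennreal (exp ((1 - t) * ((1 - k) * p1 + k * q1) + t * ((1 - k) * p2 + k * q2))) <
      asplund_sum t f g ((1 - t) *\<^sub>R ((1 - k) *\<^sub>R x1 + k *\<^sub>R x2) + t *\<^sub>R ((1 - k) *\<^sub>R y1 + k *\<^sub>R y2))"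
    using log_mean_less_asplund_sum[OF t] unfolding log_mean_less_def by blast
  also have "(1 - t) * ((1 - k) * p1 + k * q1) + t * ((1 - k) * p2 + k * q2) = (1 - k) * p + k * q"
    by (simp add: 1 2 algebra_simps)
  also have "(1 - t) *\<^sub>R ((1 - k) *\<^sub>R x1 + k *\<^sub>R x2) + t *\<^sub>R ((1 - k) *\<^sub>R y1 + k *\<^sub>R y2) =
      (1 - k) *\<^sub>R z + k *\<^sub>R w"
    by (simp add: 1 2 algebra_simps)
  finally show "ennreal (exp ((1 - k) * p + k * q)) < asplund_sum t f g ((1 - k) *\<^sub>R z + k *\<^sub>R w)" .
qed

theorem theorem1p5:
  fixes f g :: "real ^ 'n \<Rightarrow> real" and t :: real
  assumes "log_concave f" and "log_concave g"
    and "(f \<longlongrightarrow> 0) at_infinity" and "(g \<longlongrightarrow> 0) at_infinity"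
    and "0 < t" and "t < 1"
    and "\<exists>H :: (real ^ 'n) set. subspace H \<and> dim H = CARD('n) - 1 \<and>
           (\<integral>\<^sup>+x. proj_H H (\<lambda>y. ennreal (f y)) x \<partial>subspace_lebesgue H) =
             (\<integral>\<^sup>+x. proj_H H (\<lambda>y. ennreal (g y)) x \<partial>subspace_lebesgue H) \<and>
           (\<integral>\<^sup>+x. proj_H H (\<lambda>y. ennreal (g y)) x \<partial>subspace_lebesgue H) < \<infinity>"
  shows "(\<integral>\<^sup>+x. asplund_sum t f g x \<partial>lebesgue) \<ge>
           ennreal (1 - t) * (\<integral>\<^sup>+x. ennreal (f x) \<partial>lebesgue)
             + ennreal t * (\<integral>\<^sup>+x. ennreal (g x) \<partial>lebesgue)"
proof -
  obtain H :: "(real ^ 'n) set" where H: "subspace H" "dim H = CARD('n) - 1"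
    and eq: "(\<integral>\<^sup>+x. proj_H H (\<lambda>y. ennreal (f y)) x \<partial>subspace_lebesgue H) =
             (\<integral>\<^sup>+x. proj_H H (\<lambda>y. ennreal (g y)) x \<partial>subspace_lebesgue H)"
    using assms(7) by auto
  \<comment> \<open>\<open>CARD('n)\<close> is positive, so the subtraction is not truncated and
    \<open>H\<close> is proper.\<close>
  have "dim H < DIM(real ^ 'n)" using H(2) by (simp add: diff_less)
  then obtain \<nu> where \<nu>: "is_unit_normal H \<nu>"
    using is_unit_normal_exists[OF H(1)] by auto
  note lc = log_concave_ext_ennreal[OF assms(1)] log_concave_ext_ennreal[OF assms(2)]
  show ?thesis
    \<comment> \<open>Completing a measure changes no non-negative integral, so
      \<open>lborel\<close> may replace \<open>lebesgue\<close>.\<close>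
    unfolding nn_integral_completion
  proof (rule linear_prekopa_leindler)
    show "\<nu> \<bullet> \<nu> = 1" using \<nu> by (simp add: is_unit_normal_def dot_square_norm)
    show "long_fibre_mass \<nu> (\<lambda>x. ennreal (f x)) 0 = long_fibre_mass \<nu> (\<lambda>x. ennreal (g x)) 0"
      using eq H \<nu> by (simp add: long_fibre_mass_0_eq_proj[OF lc(1), of H \<nu>]
          long_fibre_mass_0_eq_proj[OF lc(2), of H \<nu>])
  qed (use assms in \<open>simp_all add: lc log_concave_ext_asplund_sum log_mean_less_asplund_sum\<close>)
qed

end
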